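(* Let $\alpha>0$, let $\mathbf{e}_1,\mathbf{e}_2,\mathbf{e}_3$ be a left invariant frame on $\mathrm{E}(1,1)$ with non-zero brackets $[\mathbf{e}_2,\mathbf{e}_3]=\mathbf{e}_1$ and $[\mathbf{e}_1,\mathbf{e}_2]=-\mathbf{e}_3$, with dual coframe $\omega^1,\omega^2,\omega^3$, and let $A,B>0$. The left invariant metric $\mathbf{g}=A\,\omega^{1}\otimes\omega^{1}+B\,\omega^{2}\otimes\omega^{2}+\omega^{3}\otimes\omega^{3}$ is a steady algebraic soliton that gives rise to a self-similar solution of the $\mathrm{RG}$-$2$ flow (with coupling constant $\alpha$) on $\mathrm{E}(1,1)$ if and only if one of the following holds: 1. $A=1$ and $\alpha=2B$; or 2. $A\in\{\frac13,3\}$ and $\alpha=\frac34B$.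
   Context: $\mathrm{E}(1,1)$ is the simply connected solvable three-dimensional Lie group of isometries of the Lorentz–Minkowski plane, whose Lie algebra $\mathfrak{h}$ has a basis with the stated brackets, $[\mathbf{e}_3,\mathbf{e}_1]=0$. The $\mathrm{RG}$-$2$ flow with coupling constant $\alpha$ is $\frac{\partial\mathbf{g}}{\partial t}=\mathbf{RG}[\mathbf{g}]:=-2\mathbf{Rc}[\mathbf{g}]-\frac{\alpha}{2}\mathbf{Rm}^{2}[\mathbf{g}]$, where $\mathbf{Rc}[\mathbf{g}]$ is the Ricci tensor and $\mathbf{Rm}^{2}[\mathbf{g}]$ has components $\check{R}_{ij}=Rm_{iklm}Rm_{jpqr}g^{kp}g^{lq}g^{mr}$, with $Rm_{ijkl}$ the Riemannian curvature tensor of $\mathbf{g}$. The operator $\widehat{\mathbf{RG}[\mathbf{g}]}:\mathfrak{h}\to\mathfrak{h}$ is defined by $\mathbf{g}(\widehat{\mathbf{RG}[\mathbf{g}]}(X),Y)=\mathbf{RG}[\mathbf{g}](X,Y)$. A left invariant metric $\mathbf{g}$ is a steady algebraic soliton for the flow if $\widehat{\mathbf{RG}[\mathbf{g}]}$ is a derivation of $\mathfrak{h}$ (i.e. $\widehat{\mathbf{RG}[\mathbf{g}]}-\kappa\,\mathrm{Id}$ is a derivation with $\kappa=0$). It gives rise to a self-similar solution if the solution of the flow starting at $\mathbf{g}$ has the form $\mathbf{g}(t)=c(t)\varphi_t^{*}\mathbf{g}$ with $\varphi_t$ a one-parameter family of diffeomorphisms, $\varphi_0=\mathrm{Id}$,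 and $c(0)=1$. *)

theory Defs
  imports "HOL-Analysis.Analysis"
begin

section \<open>Smooth maps and diffeomorphisms\<close>

text \<open>The derivative is taken within the set, so that half-open time intervals are covered.\<close>

primrec Ck_on :: "nat \<Rightarrow> 'a::real_normed_vector set \<Rightarrow> ('a \<Rightarrow> 'b::real_normed_vector) \<Rightarrow> bool" where
  "Ck_on 0 S f \<longleftrightarrow> continuous_on S f"
| "Ck_on (Suc k) S f \<longleftrightarrow>
     (\<exists>f'. (\<forall>x\<in>S. (f has_derivative f' x) (at x within S)) \<and> (\<forall>v. Ck_on k S (\<lambda>x. f' x v)))"

definition smooth_on :: "'a::real_normed_vector set \<Rightarrow> ('a \<Rightarrow> 'b::real_normed_vector) \<Rightarrow> bool" where
  "smooth_on S f \<longleftrightarrow> (\<forall>k. Ck_on k S f)"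

definition diffeomorphism :: "('a::real_normed_vector \<Rightarrow> 'b::real_normed_vector) \<Rightarrow> bool" where
  "diffeomorphism f \<longleftrightarrow> bij f \<and> smooth_on UNIV f \<and> smooth_on UNIV (inv f)"


section \<open>Tensor fields and curvature in a global chart\<close>

text \<open>
  The manifolds are copies of \<open>\<real>\<^sup>n\<close>, with coordinate frame \<open>\<partial>\<^sub>i = axis i 1\<close>.  A tensor field of
  type (0,2) sends a point to a bilinear form on the tangent space.
\<close>

type_synonym 'n vfield = "real^'n \<Rightarrow> real^'n"
type_synonym 'n oneform = "real^'n \<Rightarrow> real^'n \<Rightarrow> real"
type_synonym 'n tensor2 = "real^'n \<Rightarrow> real^'n \<Rightarrow> real^'n \<Rightarrow> real"

definition tensor_prod :: "'n oneform \<Rightarrow> 'n oneform \<Rightarrow> 'n tensor2" where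
  "tensor_prod \<theta> \<eta> p v w = \<theta> p v * \<eta> p w"

definition pullback :: "(real^'m \<Rightarrow> real^'n) \<Rightarrow> 'n tensor2 \<Rightarrow> 'm::finite tensor2" where
  "pullback f T p v w =
     T (f p) (frechet_derivative f (at p) v) (frechet_derivative f (at p) w)"

definition lie_bracket :: "'n::finite vfield \<Rightarrow> 'n vfield \<Rightarrow> 'n vfield" where
  "lie_bracket X Y p =
     frechet_derivative Y (at p) (X p) - frechet_derivative X (at p) (Y p)"

definition riemannian_metric :: "'n::finite tensor2 \<Rightarrow> bool" where
  "riemannian_metric g \<longleftrightarrow>
     (\<forall>p. bilinear (g p) \<and> (\<forall>v w. g p v w = g p w v) \<and> (\<forall>v. v \<noteq> 0 \<longrightarrow> g p v v > 0)) \<and>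
     (\<forall>v w. smooth_on UNIV (\<lambda>p. g p v w))"

definition partial_deriv :: "'n::finite \<Rightarrow> (real^'n \<Rightarrow> real) \<Rightarrow> real^'n \<Rightarrow> real" where
  "partial_deriv i f p = frechet_derivative f (at p) (axis i 1)"

definition metric_comp :: "'n::finite tensor2 \<Rightarrow> 'n \<Rightarrow> 'n \<Rightarrow> real^'n \<Rightarrow> real" where
  "metric_comp g i j p = g p (axis i 1) (axis j 1)"

definition metric_inv_comp :: "'n::finite tensor2 \<Rightarrow> 'n \<Rightarrow> 'n \<Rightarrow> real^'n \<Rightarrow> real" where
  "metric_inv_comp g i j p = matrix_inv (\<chi> k l. metric_comp g k l p) $ i $ j"

text \<open>\<open>christoffel g k i j\<close> is \<open>\<Gamma>\<close> with upper index \<open>k\<close> and lower indices \<open>i, j\<close>.\<close>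

definition christoffel :: "'n::finite tensor2 \<Rightarrow> 'n \<Rightarrow> 'n \<Rightarrow> 'n \<Rightarrow> real^'n \<Rightarrow> real" where
  "christoffel g k i j p =
     (1/2) * (\<Sum>l\<in>UNIV. metric_inv_comp g k l p *
       (partial_deriv i (metric_comp g j l) p + partial_deriv j (metric_comp g i l) p
        - partial_deriv l (metric_comp g i j) p))"

text \<open>
  \<open>R(\<partial>\<^sub>i, \<partial>\<^sub>j) \<partial>\<^sub>k = \<Sum>\<^sub>l riem_up g i j k l \<partial>\<^sub>l\<close> with
  \<open>R(X,Y)Z = \<nabla>\<^sub>X \<nabla>\<^sub>Y Z - \<nabla>\<^sub>Y \<nabla>\<^sub>X Z - \<nabla>\<^sub>[\<^sub>X\<^sub>,\<^sub>Y\<^sub>] Z\<close>.  The Ricci tensor is the trace of \<open>X \<mapsto> R(X,Y)Z\<close>, so it is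
  positive on round spheres.
\<close>

definition riem_up :: "'n::finite tensor2 \<Rightarrow> 'n \<Rightarrow> 'n \<Rightarrow> 'n \<Rightarrow> 'n \<Rightarrow> real^'n \<Rightarrow> real" where
  "riem_up g i j k l p =
     partial_deriv i (christoffel g l j k) p - partial_deriv j (christoffel g l i k) p
     + (\<Sum>m\<in>UNIV. christoffel g m j k p * christoffel g l i m p
                 - christoffel g m i k p * christoffel g l j m p)"

definition riem :: "'n::finite tensor2 \<Rightarrow> 'n \<Rightarrow> 'n \<Rightarrow> 'n \<Rightarrow> 'n \<Rightarrow> real^'n \<Rightarrow> real" where
  "riem g i j k l p = (\<Sum>m\<in>UNIV. metric_comp g l m p * riem_up g i j k m p)"

definition ricci_comp :: "'n::finite tensor2 \<Rightarrow> 'n \<Rightarrow> 'n \<Rightarrow> real^'n \<Rightarrow> real" where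
  "ricci_comp g j k p = (\<Sum>i\<in>UNIV. riem_up g i j k i p)"

definition riem_sq_comp :: "'n::finite tensor2 \<Rightarrow> 'n \<Rightarrow> 'n \<Rightarrow> real^'n \<Rightarrow> real" where
  "riem_sq_comp g i j x =
     (\<Sum>k\<in>UNIV. \<Sum>l\<in>UNIV. \<Sum>m\<in>UNIV. \<Sum>p\<in>UNIV. \<Sum>q\<in>UNIV. \<Sum>r\<in>UNIV.
        riem g i k l m x * riem g j p q r x *
        metric_inv_comp g k p x * metric_inv_comp g l q x * metric_inv_comp g m r x)"

definition ricci :: "'n::finite tensor2 \<Rightarrow> 'n tensor2" where
  "ricci g p v w = (\<Sum>i\<in>UNIV. \<Sum>j\<in>UNIV. ricci_comp g i j p * v $ i * w $ j)"

definition riem_sq :: "'n::finite tensor2 \<Rightarrow> 'n tensor2" where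
  "riem_sq g p v w = (\<Sum>i\<in>UNIV. \<Sum>j\<in>UNIV. riem_sq_comp g i j p * v $ i * w $ j)"


section \<open>The RG-2 flow\<close>

definition RG :: "real \<Rightarrow> 'n::finite tensor2 \<Rightarrow> 'n tensor2" where
  "RG \<alpha> g p v w = - 2 * ricci g p v w - (\<alpha>/2) * riem_sq g p v w"

definition RG2_flow_on :: "real \<Rightarrow> real \<Rightarrow> (real \<Rightarrow> 'n::finite tensor2) \<Rightarrow> bool" where
  "RG2_flow_on \<alpha> T G \<longleftrightarrow>
     (\<forall>t\<in>{0..<T}. riemannian_metric (G t) \<and>
        (\<forall>p v w. ((\<lambda>s. G s p v w) has_real_derivative RG \<alpha> (G t) p v w) (at t within {0..<T})))"

text \<open>The endomorphism \<open>\<open>RG\<close>-hat\<close> of the tangent bundle determined by \<open>g (RG_hat X, Y) = RG (X, Y)\<close>.\<close>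

definition RG_hat :: "real \<Rightarrow> 'n::finite tensor2 \<Rightarrow> 'n vfield \<Rightarrow> 'n vfield" where
  "RG_hat \<alpha> g X p = (THE v. \<forall>w. g p v w = RG \<alpha> g p (X p) w)"


section \<open>The Lie group E(1,1)\<close>

text \<open>
  The triple \<open>(a, b, s)\<close> stands for the isometry of the Lorentz--Minkowski plane given by the boost
  of rapidity \<open>s\<close> followed by the translation by \<open>(a, b)\<close>; the product is composition, see the two
  lemmas below.
\<close>

definition E11_act :: "real^3 \<Rightarrow> real^2 \<Rightarrow> real^2" where
  "E11_act p u = vector [p$1 + cosh (p$3) * u$1 + sinh (p$3) * u$2,
                         p$2 + sinh (p$3) * u$1 + cosh (p$3) * u$2]"

definition E11_mult :: "real^3 \<Rightarrow> real^3 \<Rightarrow> real^3" where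
  "E11_mult p q = vector [p$1 + cosh (p$3) * q$1 + sinh (p$3) * q$2,
                          p$2 + sinh (p$3) * q$1 + cosh (p$3) * q$2,
                          p$3 + q$3]"

lemma E11_act_mult: "E11_act (E11_mult p q) = E11_act p \<circ> E11_act q"
  by (simp add: fun_eq_iff E11_act_def E11_mult_def vec_eq_iff forall_2 sinh_add cosh_add
      algebra_simps)

lemma E11_act_isometry:
  "(E11_act p u $ 1 - E11_act p v $ 1)\<^sup>2 - (E11_act p u $ 2 - E11_act p v $ 2)\<^sup>2
   = (u$1 - v$1)\<^sup>2 - (u$2 - v$2)\<^sup>2"
proof -
  have "(E11_act p u $ 1 - E11_act p v $ 1)\<^sup>2 - (E11_act p u $ 2 - E11_act p v $ 2)\<^sup>2
      = ((cosh (p$3))\<^sup>2 - (sinh (p$3))\<^sup>2) * ((u$1 - v$1)\<^sup>2 - (u$2 - v$2)\<^sup>2)"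
    by (simp add: E11_act_def power2_eq_square algebra_simps)
  then show ?thesis
    by (simp add: cosh_square_eq)
qed

definition left_invariant_field :: "3 vfield \<Rightarrow> bool" where
  "left_invariant_field X \<longleftrightarrow>
     (\<forall>a p. X (E11_mult a p) = frechet_derivative (E11_mult a) (at p) (X p))"

definition left_invariant_metric :: "3 tensor2 \<Rightarrow> bool" where
  "left_invariant_metric g \<longleftrightarrow> riemannian_metric g \<and> (\<forall>a. pullback (E11_mult a) g = g)"

definition left_invariant_frame :: "(3 \<Rightarrow> 3 vfield) \<Rightarrow> bool" where
  "left_invariant_frame e \<longleftrightarrow>
     (\<forall>i. left_invariant_field (e i)) \<and>
     (\<forall>p. inj (\<lambda>i. e i p) \<and> independent (range (\<lambda>i. e i p)) \<and> span (range (\<lambda>i. e i p)) = UNIV)"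

definition dual_coframe :: "(3 \<Rightarrow> 3 vfield) \<Rightarrow> (3 \<Rightarrow> 3 oneform) \<Rightarrow> bool" where
  "dual_coframe e \<omega> \<longleftrightarrow>
     (\<forall>i p. linear (\<omega> i p)) \<and> (\<forall>i j p. \<omega> i p (e j p) = (if i = j then 1 else 0))"

definition lie_algebra_E11 :: "3 vfield set" where
  "lie_algebra_E11 = {X. left_invariant_field X}"

definition derivation_E11 :: "(3 vfield \<Rightarrow> 3 vfield) \<Rightarrow> bool" where
  "derivation_E11 D \<longleftrightarrow>
     (\<forall>X\<in>lie_algebra_E11. D X \<in> lie_algebra_E11) \<and>
     (\<forall>X\<in>lie_algebra_E11. \<forall>Y\<in>lie_algebra_E11. \<forall>a b.
        D (\<lambda>p. a *\<^sub>R X p + b *\<^sub>R Y p) = (\<lambda>p. a *\<^sub>R D X p + b *\<^sub>R D Y p)) \<and>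
     (\<forall>X\<in>lie_algebra_E11. \<forall>Y\<in>lie_algebra_E11.
        D (lie_bracket X Y) = (\<lambda>p. lie_bracket (D X) Y p + lie_bracket X (D Y) p))"


section \<open>Solitons\<close>

definition algebraic_soliton :: "real \<Rightarrow> real \<Rightarrow> 3 tensor2 \<Rightarrow> bool" where
  "algebraic_soliton \<alpha> \<kappa> g \<longleftrightarrow>
     left_invariant_metric g \<and> derivation_E11 (\<lambda>X p. RG_hat \<alpha> g X p - \<kappa> *\<^sub>R X p)"

definition steady_algebraic_soliton :: "real \<Rightarrow> 3 tensor2 \<Rightarrow> bool" where
  "steady_algebraic_soliton \<alpha> g \<longleftrightarrow> algebraic_soliton \<alpha> 0 g"

text \<open>
  The solution starting at a left invariant metric is the one that stays left invariant: on such
  metrics the flow is an ordinary differential equation, whose solution is unique.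
\<close>

definition gives_self_similar_solution :: "real \<Rightarrow> 3 tensor2 \<Rightarrow> bool" where
  "gives_self_similar_solution \<alpha> g \<longleftrightarrow>
     (\<exists>T>0. \<exists>G c \<phi>.
        RG2_flow_on \<alpha> T G \<and> G 0 = g \<and> (\<forall>t\<in>{0..<T}. left_invariant_metric (G t)) \<and>
        smooth_on ({0..<T} \<times> UNIV) (\<lambda>(t, p). \<phi> t p) \<and>
        (\<forall>t\<in>{0..<T}. diffeomorphism (\<phi> t)) \<and> \<phi> 0 = id \<and> c 0 = 1 \<and>
        (\<forall>t\<in>{0..<T}. G t = (\<lambda>p v w. c t * pullback (\<phi> t) g p v w)))"

end

theory Submission
  imports Defs
begin

text \<open>
  In a left invariant frame that diagonalises the metric with coefficients \<open>A, B, 1\<close>, the operator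
  \<open>RG\<close>-hat is diagonal, say with eigenvalues \<open>\<rho>\<^sub>1, \<rho>\<^sub>2, \<rho>\<^sub>3\<close>.  Because of the brackets it is a derivation
  exactly if \<open>\<rho>\<^sub>2 = 0\<close> and \<open>\<rho>\<^sub>1 = \<rho>\<^sub>3\<close>.  Milnor's formulas give all sectional curvatures the common factor
  \<open>(A + 1) / (4 A B)\<close>, with cofactors \<open>A - 3\<close>, \<open>1 - 3 A\<close> and \<open>A + 1\<close>; the two equations then factor and
  leave \<open>A = 1\<close>, \<open>\<alpha> = 2 B\<close> or \<open>(A - 3) (3 A - 1) = 0\<close>, \<open>\<alpha> = 3 B / 4\<close>.

  For the self-similar solution, the sectional curvatures do not change when \<open>A\<close> and the third
  coefficient are scaled by the same factor.  Hence with \<open>d = \<rho>\<^sub>1 = \<rho>\<^sub>3\<close> the metrics with coefficients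
  \<open>e\<^sup>d\<^sup>t A, B, e\<^sup>d\<^sup>t\<close> solve the flow, and they are the pullbacks of the initial metric under the automorphisms
  of the group that multiply \<open>e\<^sub>1, e\<^sub>3\<close> by \<open>e\<^sup>d\<^sup>t\<^sup>/\<^sup>2\<close> and fix \<open>e\<^sub>2\<close>.
\<close>

section \<open>Curvature in a frame with constant structure coefficients\<close>

definition has_partials :: "(real^'n \<Rightarrow> real) \<Rightarrow> ('n \<Rightarrow> real) \<Rightarrow> real^'n::finite \<Rightarrow> bool" where
  "has_partials f f' p \<longleftrightarrow> (f has_derivative (\<lambda>v. \<Sum>i\<in>UNIV. f' i * v $ i)) (at p)"

lemma partial_deriv_eq:
  assumes "has_partials f f' p"
  shows "partial_deriv i f p = f' i"
proof -
  have "frechet_derivative f (at p) = (\<lambda>v. \<Sum>i\<in>UNIV. f' i * v $ i)"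
    using assms frechet_derivative_at unfolding has_partials_def by metis
  then show ?thesis
    by (simp add: partial_deriv_def axis_def if_distrib cong: if_cong)
qed

lemma has_partials_const: "has_partials (\<lambda>p. c) (\<lambda>i. 0) p"
  by (simp add: has_partials_def)

lemma has_partials_add:
  assumes "has_partials f f' p" "has_partials h h' p"
  shows "has_partials (\<lambda>p. f p + h p) (\<lambda>i. f' i + h' i) p"
  using has_derivative_add[OF assms[unfolded has_partials_def]]
  by (simp add: has_partials_def sum.distrib algebra_simps)

lemma has_partials_mult:
  assumes "has_partials f f' p" "has_partials h h' p"
  shows "has_partials (\<lambda>p. f p * h p) (\<lambda>i. f' i * h p + f p * h' i) p"
  using has_derivative_mult[OF assms[unfolded has_partials_def]]
  by (simp add: has_partials_def sum.distrib sum_distrib_left sum_distrib_right algebra_simps)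

lemma has_partials_sum:
  assumes "\<And>a. a \<in> I \<Longrightarrow> has_partials (f a) (f' a) p"
  shows "has_partials (\<lambda>p. \<Sum>a\<in>I. f a p) (\<lambda>i. \<Sum>a\<in>I. f' a i) p"
proof -
  have "((\<lambda>p. \<Sum>a\<in>I. f a p) has_derivative (\<lambda>v. \<Sum>a\<in>I. \<Sum>i\<in>UNIV. f' a i * v $ i)) (at p)"
    by (intro has_derivative_sum) (use assms in \<open>simp add: has_partials_def\<close>)
  also have "(\<lambda>v. \<Sum>a\<in>I. \<Sum>i\<in>UNIV. f' a i * v $ i) = (\<lambda>v. \<Sum>i\<in>UNIV. (\<Sum>a\<in>I. f' a i) * v $ i)"
    by (subst sum.swap) (simp add: sum_distrib_right)
  finally show ?thesis by (simp add: has_partials_def)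
qed

text \<open>Uniqueness of the Levi-Civita connection: metric compatibility turns the three
  derivatives into six terms, symmetry of \<open>K\<close> cancels four of them, and the other two
  agree. A guessed connection is therefore identified by checking these two properties.\<close>

lemma christoffel_eq:
  fixes K :: "'n::finite \<Rightarrow> 'n \<Rightarrow> 'n \<Rightarrow> real"
  assumes compat: "\<And>i j l. partial_deriv i (metric_comp g j l) p
             = (\<Sum>k\<in>UNIV. K k i j * metric_comp g k l p + K k i l * metric_comp g k j p)"
    and sym: "\<And>k i j. K k i j = K k j i"
    and inv: "\<And>m k. (\<Sum>l\<in>UNIV. metric_inv_comp g m l p * metric_comp g k l p) = (if m = k then 1 else 0)"
  shows "christoffel g m i j p = K m i j"
proof -
  have 1: "partial_deriv i (metric_comp g j l) p + partial_deriv j (metric_comp g i l) p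
        - partial_deriv l (metric_comp g i j) p = (\<Sum>k\<in>UNIV. 2 * K k i j * metric_comp g k l p)" for l
    unfolding compat sum.distrib[symmetric] sum_subtractf[symmetric]
    by (rule sum.cong) (simp_all add: sym[of _ j i] sym[of _ l i] sym[of _ l j])
  have "(\<Sum>l\<in>UNIV. metric_inv_comp g m l p * (\<Sum>k\<in>UNIV. 2 * K k i j * metric_comp g k l p))
      = (\<Sum>k\<in>UNIV. 2 * K k i j * (\<Sum>l\<in>UNIV. metric_inv_comp g m l p * metric_comp g k l p))"
    by (simp only: sum_distrib_left) (subst sum.swap, simp add: mult_ac)
  also have "\<dots> = 2 * K m i j"
    by (simp add: inv if_distrib cong: if_cong)
  finally show ?thesis unfolding christoffel_def 1 by simp
qed

lemma sum_rotate3: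
  "(\<Sum>l\<in>L. \<Sum>a\<in>A. \<Sum>b\<in>B. F l a b) = (\<Sum>a\<in>A. \<Sum>b\<in>B. \<Sum>l\<in>L. F l a b)"
  by (rule trans[OF sum.swap], rule sum.cong[OF refl], rule sum.swap)

lemma sum_rotate4:
  "(\<Sum>l\<in>L. \<Sum>a\<in>A. \<Sum>b\<in>B. \<Sum>c\<in>C. F l a b c) = (\<Sum>a\<in>A. \<Sum>b\<in>B. \<Sum>c\<in>C. \<Sum>l\<in>L. F l a b c)"
  by (rule trans[OF sum.swap], rule sum.cong[OF refl], rule sum_rotate3)

text \<open>Nests the six sums of \<open>riem_sq_comp\<close> by the pairs that an inverse metric
  joins (k with p, l with q, m with r), so that the contractions can be done one at a time from the
  inside.\<close>

lemma sum_regroup6: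
  fixes X :: "'n::finite \<Rightarrow> 'n \<Rightarrow> 'n \<Rightarrow> 'n \<Rightarrow> 'n \<Rightarrow> 'n \<Rightarrow> real"
  shows "(\<Sum>k\<in>UNIV. \<Sum>l\<in>UNIV. \<Sum>m\<in>UNIV. \<Sum>p\<in>UNIV. \<Sum>q\<in>UNIV. \<Sum>r\<in>UNIV. X k l m p q r)
    = (\<Sum>m\<in>UNIV. \<Sum>r\<in>UNIV. \<Sum>l\<in>UNIV. \<Sum>q\<in>UNIV. \<Sum>k\<in>UNIV. \<Sum>p\<in>UNIV. X k l m p q r)"
proof -
  have "(\<Sum>k\<in>UNIV. \<Sum>l\<in>UNIV. \<Sum>m\<in>UNIV. \<Sum>p\<in>UNIV. \<Sum>q\<in>UNIV. \<Sum>r\<in>UNIV. X k l m p q r)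
    = (\<Sum>l\<in>UNIV. \<Sum>m\<in>UNIV. \<Sum>k\<in>UNIV. \<Sum>p\<in>UNIV. \<Sum>q\<in>UNIV. \<Sum>r\<in>UNIV. X k l m p q r)"
    by (rule sum_rotate3)
  also have "\<dots> = (\<Sum>m\<in>UNIV. \<Sum>l\<in>UNIV. \<Sum>k\<in>UNIV. \<Sum>p\<in>UNIV. \<Sum>q\<in>UNIV. \<Sum>r\<in>UNIV. X k l m p q r)"
    by (rule sum.swap)
  also have "\<dots> = (\<Sum>m\<in>UNIV. \<Sum>l\<in>UNIV. \<Sum>r\<in>UNIV. \<Sum>q\<in>UNIV. \<Sum>k\<in>UNIV. \<Sum>p\<in>UNIV. X k l m p q r)"
  proof (rule sum.cong[OF refl], rule sum.cong[OF refl])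
    fix m l
    have "(\<Sum>k\<in>UNIV. \<Sum>p\<in>UNIV. \<Sum>q\<in>UNIV. \<Sum>r\<in>UNIV. X k l m p q r)
      = (\<Sum>r\<in>UNIV. \<Sum>k\<in>UNIV. \<Sum>p\<in>UNIV. \<Sum>q\<in>UNIV. X k l m p q r)"
      by (rule sum_rotate4[symmetric])
    also have "\<dots> = (\<Sum>r\<in>UNIV. \<Sum>q\<in>UNIV. \<Sum>k\<in>UNIV. \<Sum>p\<in>UNIV. X k l m p q r)"
      by (rule sum.cong[OF refl], rule sum_rotate3[symmetric])
    finally show "(\<Sum>k\<in>UNIV. \<Sum>p\<in>UNIV. \<Sum>q\<in>UNIV. \<Sum>r\<in>UNIV. X k l m p q r)
      = (\<Sum>r\<in>UNIV. \<Sum>q\<in>UNIV. \<Sum>k\<in>UNIV. \<Sum>p\<in>UNIV. X k l m p q r)" .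
  qed
  also have "\<dots> = (\<Sum>m\<in>UNIV. \<Sum>r\<in>UNIV. \<Sum>l\<in>UNIV. \<Sum>q\<in>UNIV. \<Sum>k\<in>UNIV. \<Sum>p\<in>UNIV. X k l m p q r)"
    by (rule sum.cong[OF refl], rule sum.swap)
  finally show ?thesis .
qed

lemma matrix_inv_eqI:
  fixes G H :: "real^'n::finite^'n"
  assumes 1: "H ** G = mat 1"
  shows "matrix_inv G = H"
proof -
  have 2: "G ** H = mat 1" using 1 by (simp add: matrix_left_right_inverse)
  have "G ** matrix_inv G = mat 1"
    unfolding matrix_inv_def by (rule someI2[of _ H]) (rule conjI[OF 2 1], erule conjunct1)
  then show ?thesis using 1 by (metis (no_types) matrix_mul_assoc matrix_mul_lid matrix_mul_rid)
qed

text \<open>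
  Koszul's formula for \<open>\<nabla>\<^sub>a e\<^sub>b = \<Sum>\<^sub>c frame_conn s D a b c e\<^sub>c\<close> when \<open>[e\<^sub>a, e\<^sub>b] = \<Sum>\<^sub>c s a b c e\<^sub>c\<close> and the \<open>e\<^sub>a\<close> are
  orthogonal with squared lengths \<open>D a\<close>.
\<close>

definition frame_conn :: "('n \<Rightarrow> 'n \<Rightarrow> 'n \<Rightarrow> real) \<Rightarrow> ('n \<Rightarrow> real) \<Rightarrow> 'n \<Rightarrow> 'n \<Rightarrow> 'n \<Rightarrow> real" where
  "frame_conn s D a b c = (s a b c * D c - s b c a * D a + s c a b * D b) / (2 * D c)"

text \<open>The coefficient of \<open>e d\<close> in R(\<open>e a\<close>, \<open>e b\<close>)
  \<open>e c\<close>, with the sign convention of \<open>riem_up\<close>. The connection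
  coefficients in the frame are constant, so no derivatives occur.\<close>

definition frame_curv :: "('n::finite \<Rightarrow> 'n \<Rightarrow> 'n \<Rightarrow> real) \<Rightarrow> ('n \<Rightarrow> real) \<Rightarrow> 'n \<Rightarrow> 'n \<Rightarrow> 'n \<Rightarrow> 'n \<Rightarrow> real" where
  "frame_curv s D a b c d = (\<Sum>f\<in>UNIV. frame_conn s D b c f * frame_conn s D a f d
     - frame_conn s D a c f * frame_conn s D b f d - s a b f * frame_conn s D f c d)"

definition frame_curv_sq :: "('n::finite \<Rightarrow> 'n \<Rightarrow> 'n \<Rightarrow> real) \<Rightarrow> ('n \<Rightarrow> real) \<Rightarrow> 'n \<Rightarrow> 'n \<Rightarrow> real" where
  "frame_curv_sq s D a a' = (\<Sum>b\<in>UNIV. \<Sum>c\<in>UNIV. \<Sum>d\<in>UNIV.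
     (D d * frame_curv s D a b c d) * (D d * frame_curv s D a' b c d) / (D b * D c * D d))"

text \<open>
  \<open>E a\<close> and \<open>W a\<close> are the coordinates of the frame field \<open>e\<^sub>a\<close> and of its dual form.  The frame is parallel
  for the flat connection with constant matrices \<open>- N i\<close>, that is \<open>\<partial>\<^sub>i E = N\<^sub>i E\<close> and \<open>\<partial>\<^sub>i W = - W N\<^sub>i\<close>.  In this
  gauge the Levi-Civita connection is \<open>- N\<^sub>i\<close> plus the tensor \<open>cmat i\<close> below, and all derivatives drop
  out of its curvature.
\<close>

locale parallel_frame =
  fixes E W :: "'n::finite \<Rightarrow> 'n \<Rightarrow> real^'n \<Rightarrow> real"
    and N s :: "'n \<Rightarrow> 'n \<Rightarrow> 'n \<Rightarrow> real"
    and D :: "'n \<Rightarrow> real"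
    and g :: "'n tensor2"
  assumes WE: "\<And>a b p. (\<Sum>i\<in>UNIV. W a i p * E b i p) = (if a = b then 1 else 0)"
    and EW: "\<And>i j p. (\<Sum>a\<in>UNIV. E a i p * W a j p) = (if i = j then 1 else 0)"
    and dE: "\<And>a i p. has_partials (E a i) (\<lambda>k. \<Sum>m\<in>UNIV. N k i m * E a m p) p"
    and dW: "\<And>a i p. has_partials (W a i) (\<lambda>k. - (\<Sum>m\<in>UNIV. W a m p * N k m i)) p"
    and N_comm: "\<And>i j k l. (\<Sum>m\<in>UNIV. N i k m * N j m l) = (\<Sum>m\<in>UNIV. N j k m * N i m l)"
    and bracket: "\<And>a b l p. (\<Sum>i\<in>UNIV. \<Sum>k\<in>UNIV. E a i p * E b k p * (N i l k - N k l i))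
                    = (\<Sum>c\<in>UNIV. s a b c * E c l p)"
    and s_skew: "\<And>a b c. s a b c = - s b a c"
    and D_nz: "\<And>a. D a \<noteq> 0"
    and g_comp: "\<And>i j p. metric_comp g i j p = (\<Sum>b\<in>UNIV. D b * W b i p * W b j p)"
begin

section \<open>Contractions with the frame and the difference of the two connections\<close>

abbreviation "conn \<equiv> frame_conn s D"
abbreviation "curv \<equiv> frame_curv s D"
abbreviation "curv_sq \<equiv> frame_curv_sq s D"

lemma contract: "(\<Sum>i\<in>UNIV. (\<Sum>b\<in>UNIV. f b * W b i p) * E c i p) = f c"
proof -
  have "(\<Sum>i\<in>UNIV. (\<Sum>b\<in>UNIV. f b * W b i p) * E c i p)
      = (\<Sum>b\<in>UNIV. f b * (\<Sum>i\<in>UNIV. W b i p * E c i p))"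
    by (simp only: sum_distrib_left sum_distrib_right) (subst sum.swap, simp add: mult_ac)
  then show ?thesis by (simp add: WE if_distrib cong: if_cong)
qed

lemma contract': "(\<Sum>b\<in>UNIV. (\<Sum>i\<in>UNIV. f i * E b i p) * W b k p) = f k"
proof -
  have "(\<Sum>b\<in>UNIV. (\<Sum>i\<in>UNIV. f i * E b i p) * W b k p)
      = (\<Sum>i\<in>UNIV. f i * (\<Sum>b\<in>UNIV. E b i p * W b k p))"
    by (simp only: sum_distrib_left sum_distrib_right) (subst sum.swap, simp add: mult_ac)
  then show ?thesis by (simp add: EW if_distrib cong: if_cong)
qed

lemma flat: "(\<Sum>k\<in>UNIV. (\<Sum>b\<in>UNIV. D b * W b i p * W b k p) * E c k p) = D c * W c i p"
  by (rule contract)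

lemma contract_sharp:
  "(\<Sum>k\<in>UNIV. (\<Sum>b\<in>UNIV. E b i p * E b k p / D b) * f k)
    = (\<Sum>b\<in>UNIV. E b i p / D b * (\<Sum>k\<in>UNIV. f k * E b k p))"
  by (simp only: sum_distrib_left sum_distrib_right) (subst sum.swap, simp add: mult_ac)

lemma metric_mult_inv:
  "(\<Sum>k\<in>UNIV. (\<Sum>b\<in>UNIV. E b i p * E b k p / D b) * (\<Sum>b\<in>UNIV. D b * W b j p * W b k p))
    = (if i = j then 1 else 0)"
  unfolding contract_sharp flat using D_nz EW[of i p j] by simp

lemma metric_inv_comp_eq: "metric_inv_comp g i j p = (\<Sum>b\<in>UNIV. E b i p * E b j p / D b)"
proof -
  let ?G = "\<chi> k l. metric_comp g k l p" and ?H = "\<chi> k l. \<Sum>b\<in>UNIV. E b k p * E b l p / D b"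
  have "?H ** ?G = mat 1"
    by (simp add: vec_eq_iff matrix_matrix_mult_def mat_def g_comp)
       (use metric_mult_inv in \<open>simp add: mult_ac\<close>)
  then have "matrix_inv ?G = ?H" by (rule matrix_inv_eqI)
  then show ?thesis by (simp add: metric_inv_comp_def)
qed

text \<open>With \<open>conn_metric\<close> this says that Koszul's formula yields a torsion-free
  metric connection; both come from the skew-symmetry of \<open>s\<close> by clearing
  denominators.\<close>

lemma conn_torsion: "conn a b c - conn b a c = s a b c"
  using D_nz[of c] s_skew[of b a c] s_skew[of c b a] s_skew[of a c b]
  by (simp add: frame_conn_def field_simps)

lemma conn_metric: "D c * conn a b c = - (D b * conn a c b)"
  using D_nz[of c] D_nz[of b] s_skew[of a b c] s_skew[of b a c] s_skew[of c b a] s_skew[of a c b]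
  by (simp add: frame_conn_def field_simps)

text \<open>\<open>bracket\<close> speaks about pairs of frame fields. Expanding the indices i and j
  by \<open>contract'\<close> carries it over to coordinate components.\<close>

lemma N_skew: "(\<Sum>l\<in>UNIV. W c l p * (N i l j - N j l i)) = (\<Sum>a\<in>UNIV. \<Sum>b\<in>UNIV. s a b c * W a i p * W b j p)"
proof -
  have "(\<Sum>l\<in>UNIV. W c l p * (N i l j - N j l i)) = (\<Sum>l\<in>UNIV. W c l p * 
        (\<Sum>a\<in>UNIV. (\<Sum>i\<in>UNIV. (\<Sum>b\<in>UNIV. (\<Sum>k\<in>UNIV. (N i l k - N k l i) * E b k p) * W b j p) * E a i p) * W a i p))"
    unfolding contract' ..
  also have "\<dots> = (\<Sum>l\<in>UNIV. W c l p * (\<Sum>a\<in>UNIV. \<Sum>b\<in>UNIV. (\<Sum>i\<in>UNIV. \<Sum>k\<in>UNIV. E a i p * E b k p * (N i l k - N k l i)) * W a i p * W b j p))"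
  proof -
    have "(\<Sum>i'\<in>UNIV. (\<Sum>b\<in>UNIV. (\<Sum>k\<in>UNIV. (N i' l k - N k l i') * E b k p) * W b j p) * E a i' p) * W a i p
       = (\<Sum>b\<in>UNIV. (\<Sum>i\<in>UNIV. \<Sum>k\<in>UNIV. E a i p * E b k p * (N i l k - N k l i)) * W a i p * W b j p)" for a l
      by (simp only: sum_distrib_left sum_distrib_right) (subst sum.swap, simp add: mult_ac)
    then show ?thesis by simp
  qed
  also have "\<dots> = (\<Sum>l\<in>UNIV. W c l p * (\<Sum>a\<in>UNIV. \<Sum>b\<in>UNIV. (\<Sum>d\<in>UNIV. s a b d * E d l p) * W a i p * W b j p))"
    unfolding bracket ..
  also have "\<dots> = (\<Sum>a\<in>UNIV. \<Sum>b\<in>UNIV. \<Sum>d\<in>UNIV. s a b d * W a i p * W b j p * (\<Sum>l\<in>UNIV. W c l p * E d l p))"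
    apply (simp only: sum_distrib_left sum_distrib_right)
    apply (rule trans[OF sum_rotate4])
    apply (simp add: mult_ac)
    done
  also have "\<dots> = (\<Sum>a\<in>UNIV. \<Sum>b\<in>UNIV. s a b c * W a i p * W b j p)"
    by (simp add: WE if_distrib cong: if_cong)
  finally show ?thesis .
qed

text \<open>The connection forms: the \<open>e c\<close> component of the covariant derivative of
  \<open>e b\<close> along the i-th coordinate field.\<close>

definition cform :: "'n \<Rightarrow> 'n \<Rightarrow> 'n \<Rightarrow> real^'n \<Rightarrow> real" where
  "cform i b c p = (\<Sum>a\<in>UNIV. W a i p * conn a b c)"

text \<open>The connection forms as matrices on coordinate vectors. As the frame is parallel for the
  flat connection, this is the difference tensor between the Levi-Civita and the flat
  connection.\<close>

definition cmat :: "'n \<Rightarrow> 'n \<Rightarrow> 'n \<Rightarrow> real^'n \<Rightarrow> real" where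
  "cmat i l k p = (\<Sum>b\<in>UNIV. \<Sum>c\<in>UNIV. E c l p * cform i b c p * W b k p)"

text \<open>Equivalent to the symmetry of \<open>cmat - N\<close> in its lower indices, that is, to
  vanishing torsion of the candidate for the Levi-Civita connection.\<close>

lemma N_skew': "N i l j - N j l i = cmat i l j p - cmat j l i p"
proof -
  have "N i l j - N j l i = (\<Sum>c\<in>UNIV. E c l p * (\<Sum>l\<in>UNIV. W c l p * (N i l j - N j l i)))"
  proof -
    have "(\<Sum>c\<in>UNIV. E c l p * (\<Sum>l\<in>UNIV. W c l p * (N i l j - N j l i)))
       = (\<Sum>m\<in>UNIV. (N i m j - N j m i) * (\<Sum>c\<in>UNIV. E c l p * W c m p))"
      by (simp only: sum_distrib_left) (subst sum.swap, simp add: mult_ac)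
    then show ?thesis by (simp add: EW if_distrib cong: if_cong)
  qed
  also have "\<dots> = (\<Sum>c\<in>UNIV. \<Sum>a\<in>UNIV. \<Sum>b\<in>UNIV. E c l p * (conn a b c - conn b a c) * W a i p * W b j p)"
    unfolding N_skew conn_torsion by (simp add: sum_distrib_left mult_ac)
  also have "\<dots> = cmat i l j p - cmat j l i p"
  proof -
    have 1: "cmat i l j p = (\<Sum>c\<in>UNIV. \<Sum>a\<in>UNIV. \<Sum>b\<in>UNIV. E c l p * conn a b c * W a i p * W b j p)" for i j
      unfolding cmat_def cform_def
      apply (simp only: sum_distrib_left sum_distrib_right)
      apply (rule trans[OF sum.swap])
      apply (rule sum.cong[OF refl])
      apply (rule trans[OF sum.swap])
      apply (simp add: mult_ac)
      done
    have 2: "cmat j l i p = (\<Sum>c\<in>UNIV. \<Sum>a\<in>UNIV. \<Sum>b\<in>UNIV. E c l p * conn b a c * W a i p * W b j p)"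
      unfolding 1 by (rule sum.cong[OF refl], subst sum.swap) (simp add: mult_ac)
    show ?thesis unfolding 1[of i j] 2 by (simp add: sum_subtractf algebra_simps)
  qed
  finally show ?thesis .
qed

lemma lower_cmat:
  "(\<Sum>k\<in>UNIV. cmat i k j p * (\<Sum>b\<in>UNIV. D b * W b k p * W b l p))
    = (\<Sum>b\<in>UNIV. \<Sum>c\<in>UNIV. \<Sum>a\<in>UNIV. W a i p * W b j p * W c l p * (D c * conn a b c))"
proof -
  have "(\<Sum>k\<in>UNIV. cmat i k j p * (\<Sum>b\<in>UNIV. D b * W b k p * W b l p))
     = (\<Sum>b\<in>UNIV. \<Sum>c\<in>UNIV. cform i b c p * W b j p * (\<Sum>k\<in>UNIV. (\<Sum>b\<in>UNIV. D b * W b l p * W b k p) * E c k p))"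
    unfolding cmat_def sum_distrib_right[of _ _ "\<Sum>b\<in>UNIV. D b * W b _ p * W b l p"]
    unfolding sum_distrib_left[of "cform _ _ _ _ * W _ _ _"]
    apply (rule trans[OF sum_rotate3])
    apply (simp add: mult_ac)
    done
  also have "\<dots> = (\<Sum>b\<in>UNIV. \<Sum>c\<in>UNIV. \<Sum>a\<in>UNIV. W a i p * W b j p * W c l p * (D c * conn a b c))"
    unfolding flat cform_def by (simp add: sum_distrib_right sum_distrib_left mult_ac)
  finally show ?thesis .
qed

text \<open>The flat connection preserves the metric (\<open>metric_partials\<close>), because the
  parallel frame has constant inner products. Compatibility of \<open>cmat - N\<close> thus reduces
  to this skewness, which is \<open>conn_metric\<close> in coordinates.\<close>

lemma lower_cmat_skew:
  "(\<Sum>k\<in>UNIV. cmat i k j p * (\<Sum>b\<in>UNIV. D b * W b k p * W b l p))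
    = - (\<Sum>k\<in>UNIV. cmat i k l p * (\<Sum>b\<in>UNIV. D b * W b k p * W b j p))"
  unfolding lower_cmat
  apply (subst (2) sum.swap)
  apply (subst conn_metric)
  apply (simp add: sum_negf mult_ac)
  done

section \<open>Christoffel symbols and Riemann tensor in the parallel gauge\<close>

lemma metric_partials:
  "partial_deriv i (metric_comp g j l) p
     = - (\<Sum>k\<in>UNIV. N i k j * metric_comp g k l p + N i k l * metric_comp g k j p)"
proof -
  have *: "metric_comp g j l = (\<lambda>p. \<Sum>b\<in>UNIV. D b * W b j p * W b l p)"
    by (simp add: fun_eq_iff g_comp)
  have "has_partials (metric_comp g j l) (\<lambda>i. \<Sum>b\<in>UNIV. (0 * W b j p + D b * (- (\<Sum>m\<in>UNIV. W b m p * N i m j))) * W b l p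
      + D b * W b j p * (- (\<Sum>m\<in>UNIV. W b m p * N i m l))) p"
    unfolding * by (intro has_partials_sum has_partials_mult has_partials_const dW)
  from partial_deriv_eq[OF this]
  have "partial_deriv i (metric_comp g j l) p = - (\<Sum>b\<in>UNIV. \<Sum>m\<in>UNIV. N i m j * (D b * W b m p * W b l p) + N i m l * (D b * W b m p * W b j p))"
    by (simp add: sum_distrib_left sum_distrib_right sum.distrib sum_negf sum_subtractf mult_ac)
  also have "\<dots> = - (\<Sum>m\<in>UNIV. \<Sum>b\<in>UNIV. N i m j * (D b * W b m p * W b l p) + N i m l * (D b * W b m p * W b j p))"
    by (subst sum.swap) simp
  finally show ?thesis by (simp add: g_comp sum_distrib_left sum.distrib)
qed

lemma christoffel_frame: "christoffel g l i j p = cmat i l j p - N i l j"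
proof (rule christoffel_eq)
  fix i j l
  show "partial_deriv i (metric_comp g j l) p = (\<Sum>k\<in>UNIV.
      (cmat i k j p - N i k j) * metric_comp g k l p + (cmat i k l p - N i k l) * metric_comp g k j p)"
    unfolding metric_partials g_comp left_diff_distrib
    using lower_cmat_skew[of i j p l]
    by (simp add: sum.distrib sum_subtractf)
next
  show "cmat i k j p - N i k j = cmat j k i p - N j k i" for k i j
    using N_skew'[of i k j p] by simp
next
  show "(\<Sum>l\<in>UNIV. metric_inv_comp g m l p * metric_comp g k l p) = (if m = k then 1 else 0)" for m k
    unfolding metric_inv_comp_eq g_comp by (rule metric_mult_inv)
qed

lemma has_partials_cform:
  "has_partials (cform j b c) (\<lambda>i. - (\<Sum>m\<in>UNIV. N i m j * cform m b c p)) p"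
proof -
  have "has_partials (cform j b c) (\<lambda>i. \<Sum>a\<in>UNIV. (- (\<Sum>m\<in>UNIV. W a m p * N i m j)) * conn a b c + W a j p * 0) p"
    unfolding cform_def[abs_def] by (intro has_partials_sum has_partials_mult has_partials_const dW)
  also have "(\<lambda>i. \<Sum>a\<in>UNIV. (- (\<Sum>m\<in>UNIV. W a m p * N i m j)) * conn a b c + W a j p * 0)
     = (\<lambda>i. - (\<Sum>m\<in>UNIV. N i m j * cform m b c p))"
    unfolding cform_def sum_distrib_left
    by (rule ext, rule trans[OF _ arg_cong[where f=uminus, OF sum.swap]])
       (simp add: sum_distrib_left sum_distrib_right sum_negf mult_ac)
  finally show ?thesis .
qed

text \<open>The difference tensor is parallel for the flat connection: its coefficients
  \<open>conn\<close> in the frame are constant, so each index contributes only its term with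
  \<open>N\<close>.\<close>

lemma has_partials_cmat:
  "has_partials (cmat j l k) (\<lambda>i. \<Sum>m\<in>UNIV. N i l m * cmat j m k p - N i m j * cmat m l k p
     - N i m k * cmat j l m p) p"
proof -
  have "has_partials (cmat j l k) (\<lambda>i. \<Sum>b\<in>UNIV. \<Sum>c\<in>UNIV.
     ((\<Sum>m\<in>UNIV. N i l m * E c m p) * cform j b c p + E c l p * (- (\<Sum>m\<in>UNIV. N i m j * cform m b c p))) * W b k p
      + (E c l p * cform j b c p) * (- (\<Sum>m\<in>UNIV. W b m p * N i m k))) p" (is "has_partials _ ?R _")
    unfolding cmat_def[abs_def]
    by (intro has_partials_sum has_partials_mult has_partials_cform dW dE)
  also have "?R = (\<lambda>i. \<Sum>b\<in>UNIV. \<Sum>c\<in>UNIV. \<Sum>m\<in>UNIV. N i l m * (E c m p * cform j b c p * W b k p)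
     - N i m j * (E c l p * cform m b c p * W b k p) - N i m k * (E c l p * cform j b c p * W b m p))"
    by (simp add: sum_distrib_left sum_distrib_right sum_subtractf sum.distrib sum_negf algebra_simps)
  also have "\<dots> = (\<lambda>i. \<Sum>m\<in>UNIV. \<Sum>b\<in>UNIV. \<Sum>c\<in>UNIV. N i l m * (E c m p * cform j b c p * W b k p)
     - N i m j * (E c l p * cform m b c p * W b k p) - N i m k * (E c l p * cform j b c p * W b m p))"
    by (rule ext, rule sum_rotate3[symmetric])
  also have "\<dots> = (\<lambda>i. \<Sum>m\<in>UNIV. N i l m * cmat j m k p - N i m j * cmat m l k p - N i m k * cmat j l m p)"
    unfolding cmat_def by (simp add: sum_distrib_left sum_subtractf)
  finally show ?thesis .
qed

text \<open>Insert \<open>cmat - N\<close> into the curvature. The terms quadratic in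
  \<open>N\<close> vanish by \<open>N_comm\<close>, and the derivatives of \<open>cmat\<close>
  cancel the mixed commutators up to the torsion term of the flat connection.\<close>

lemma riem_up_cmat:
  "riem_up g i j k l p = (\<Sum>m\<in>UNIV. cmat i l m p * cmat j m k p - cmat j l m p * cmat i m k p)
     - (\<Sum>m\<in>UNIV. (N i m j - N j m i) * cmat m l k p)"
proof -
  have *: "christoffel g l j k = (\<lambda>p. cmat j l k p + (- N j l k))" for l j k
    by (simp add: fun_eq_iff christoffel_frame)
  have "partial_deriv i (christoffel g l j k) p = (\<Sum>m\<in>UNIV. N i l m * cmat j m k p - N i m j * cmat m l k p
     - N i m k * cmat j l m p)" for i j
    unfolding * using partial_deriv_eq[OF has_partials_add[OF has_partials_cmat[of j l k p] has_partials_const[of "- N j l k"]], of i] by simp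
  then show ?thesis
    unfolding riem_up_def christoffel_frame using N_comm[of i l j k]
    by (simp add: sum_subtractf sum.distrib algebra_simps)
qed

lemma cmat_mult:
  "(\<Sum>m\<in>UNIV. cmat i l m p * cmat j m k p)
    = (\<Sum>c\<in>UNIV. \<Sum>d\<in>UNIV. (\<Sum>f\<in>UNIV. cform i f d p * cform j c f p) * W c k p * E d l p)"
proof -
  have "(\<Sum>m\<in>UNIV. cmat i l m p * cmat j m k p)
     = (\<Sum>m\<in>UNIV. (\<Sum>f\<in>UNIV. (\<Sum>d\<in>UNIV. E d l p * cform i f d p) * W f m p) * (\<Sum>c\<in>UNIV. \<Sum>b\<in>UNIV. cform j c b p * W c k p * E b m p))"
  proof -
    have "cmat i l m p = (\<Sum>f\<in>UNIV. (\<Sum>d\<in>UNIV. E d l p * cform i f d p) * W f m p)" for m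
      unfolding cmat_def by (simp add: sum_distrib_right)
    moreover have "cmat j m k p = (\<Sum>c\<in>UNIV. \<Sum>b\<in>UNIV. cform j c b p * W c k p * E b m p)" for m
      unfolding cmat_def by (simp add: mult_ac)
    ultimately show ?thesis by simp
  qed
  also have "\<dots> = (\<Sum>c\<in>UNIV. \<Sum>b\<in>UNIV. cform j c b p * W c k p * (\<Sum>m\<in>UNIV. (\<Sum>f\<in>UNIV. (\<Sum>d\<in>UNIV. E d l p * cform i f d p) * W f m p) * E b m p))"
    unfolding sum_distrib_left[of "\<Sum>f\<in>UNIV. (\<Sum>d\<in>UNIV. E d l p * cform i f d p) * W f _ p"]
    by (rule trans[OF sum_rotate3]) (simp add: mult_ac sum_distrib_left)
  also have "\<dots> = (\<Sum>c\<in>UNIV. \<Sum>b\<in>UNIV. \<Sum>d\<in>UNIV. cform j c b p * W c k p * E d l p * cform i b d p)"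
    unfolding contract by (simp add: sum_distrib_left mult_ac)
  also have "\<dots> = (\<Sum>c\<in>UNIV. \<Sum>d\<in>UNIV. \<Sum>b\<in>UNIV. cform j c b p * W c k p * E d l p * cform i b d p)"
    by (rule sum.cong[OF refl], rule sum.swap)
  finally show ?thesis by (simp add: sum_distrib_left sum_distrib_right mult_ac)
qed

lemma N_cmat:
  "(\<Sum>m\<in>UNIV. (N i m j - N j m i) * cmat m l k p)
     = (\<Sum>c\<in>UNIV. \<Sum>d\<in>UNIV. (\<Sum>a\<in>UNIV. \<Sum>b\<in>UNIV. \<Sum>f\<in>UNIV. W a i p * W b j p * (s a b f * conn f c d)) * W c k p * E d l p)"
proof -
  have 1: "(\<Sum>m\<in>UNIV. (N i m j - N j m i) * cform m c d p)
      = (\<Sum>a\<in>UNIV. \<Sum>b\<in>UNIV. \<Sum>f\<in>UNIV. W a i p * W b j p * (s a b f * conn f c d))" for c d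
  proof -
    have "(\<Sum>m\<in>UNIV. (N i m j - N j m i) * cform m c d p)
       = (\<Sum>f\<in>UNIV. (\<Sum>m\<in>UNIV. W f m p * (N i m j - N j m i)) * conn f c d)"
      unfolding cform_def sum_distrib_left sum_distrib_right
      by (rule trans[OF sum.swap]) (simp add: mult_ac)
    also have "\<dots> = (\<Sum>f\<in>UNIV. \<Sum>a\<in>UNIV. \<Sum>b\<in>UNIV. W a i p * W b j p * (s a b f * conn f c d))"
      unfolding N_skew by (simp add: sum_distrib_left sum_distrib_right mult_ac)
    finally show ?thesis by (rule trans[OF _ sum_rotate3])
  qed
  have "(\<Sum>m\<in>UNIV. (N i m j - N j m i) * cmat m l k p)
     = (\<Sum>c\<in>UNIV. \<Sum>d\<in>UNIV. (\<Sum>m\<in>UNIV. (N i m j - N j m i) * cform m c d p) * W c k p * E d l p)"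
    unfolding cmat_def sum_distrib_left sum_distrib_right
    by (rule trans[OF sum_rotate3]) (simp add: mult_ac)
  then show ?thesis unfolding 1 .
qed

lemma cform_mult:
  "(\<Sum>f\<in>UNIV. cform i f d p * cform j c f p)
     = (\<Sum>a\<in>UNIV. \<Sum>b\<in>UNIV. \<Sum>f\<in>UNIV. W a i p * W b j p * (conn a f d * conn b c f))"
proof -
  have "(\<Sum>f\<in>UNIV. cform i f d p * cform j c f p)
      = (\<Sum>f\<in>UNIV. \<Sum>a\<in>UNIV. \<Sum>b\<in>UNIV. W a i p * W b j p * (conn a f d * conn b c f))"
    unfolding cform_def sum_product by (simp add: mult_ac)
  then show ?thesis by (rule trans[OF _ sum_rotate3])
qed

lemma riem_up_frame:
  "riem_up g i j k l p
    = (\<Sum>c\<in>UNIV. \<Sum>d\<in>UNIV. (\<Sum>a\<in>UNIV. \<Sum>b\<in>UNIV. curv a b c d * W a i p * W b j p) * W c k p * E d l p)"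
proof -
  \<comment> \<open>Exchanging the names a and b gives the second product of connection forms the
    same factors \<open>W a i p * W b j p\<close> as the first.\<close>
  have sw: "(\<Sum>f\<in>UNIV. cform j f d p * cform i c f p)
     = (\<Sum>a\<in>UNIV. \<Sum>b\<in>UNIV. \<Sum>f\<in>UNIV. W a i p * W b j p * (conn b f d * conn a c f))" for c d
    unfolding cform_mult by (rule trans[OF sum.swap]) (simp add: mult_ac)
  have "(\<Sum>a\<in>UNIV. \<Sum>b\<in>UNIV. curv a b c d * W a i p * W b j p)
     = (\<Sum>f\<in>UNIV. cform i f d p * cform j c f p) - (\<Sum>f\<in>UNIV. cform j f d p * cform i c f p)
      - (\<Sum>a\<in>UNIV. \<Sum>b\<in>UNIV. \<Sum>f\<in>UNIV. W a i p * W b j p * (s a b f * conn f c d))" for c d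
    unfolding sw cform_mult frame_curv_def
    by (simp add: sum_distrib_left sum_distrib_right sum_subtractf sum.distrib algebra_simps)
  then show ?thesis
    unfolding riem_up_cmat sum_subtractf cmat_mult N_cmat
    by (simp add: sum_subtractf left_diff_distrib)
qed

section \<open>Ricci tensor and squared curvature in the frame\<close>

lemma contract_frame: "(\<Sum>i\<in>UNIV. E c i p * (\<Sum>b\<in>UNIV. W b i p * f b)) = f c"
  using contract[of f p c] by (simp add: mult_ac)

lemma ricci_comp_frame:
  "ricci_comp g j k p = (\<Sum>b\<in>UNIV. \<Sum>c\<in>UNIV. (\<Sum>a\<in>UNIV. curv a b c a) * W b j p * W c k p)"
proof -
  have "ricci_comp g j k p = (\<Sum>i\<in>UNIV. \<Sum>c\<in>UNIV. \<Sum>d\<in>UNIV. W c k p * (E d i p * (\<Sum>a\<in>UNIV. W a i p * (\<Sum>b\<in>UNIV. curv a b c d * W b j p))))"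
    unfolding ricci_comp_def riem_up_frame by (simp add: sum_distrib_left sum_distrib_right mult_ac)
  also have "\<dots> = (\<Sum>c\<in>UNIV. \<Sum>d\<in>UNIV. W c k p * (\<Sum>i\<in>UNIV. E d i p * (\<Sum>a\<in>UNIV. W a i p * (\<Sum>b\<in>UNIV. curv a b c d * W b j p))))"
    by (rule trans[OF sum_rotate3]) (simp only: sum_distrib_left)
  also have "\<dots> = (\<Sum>c\<in>UNIV. \<Sum>d\<in>UNIV. \<Sum>b\<in>UNIV. W c k p * curv d b c d * W b j p)"
    unfolding contract_frame by (simp add: sum_distrib_left mult_ac)
  also have "\<dots> = (\<Sum>b\<in>UNIV. \<Sum>c\<in>UNIV. \<Sum>d\<in>UNIV. W c k p * curv d b c d * W b j p)"
    by (rule sum_rotate3[symmetric])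
  finally show ?thesis by (simp add: sum_distrib_left sum_distrib_right mult_ac)
qed

text \<open>The indices j, k, l that are contracted in \<open>riem_sq_comp\<close> are nested
  outermost, so that \<open>inv_contract\<close> can strip them in turn; the free index i is
  innermost.\<close>

lemma riem_frame:
  "riem g i j k l p
    = (\<Sum>b\<in>UNIV. W b j p * (\<Sum>c\<in>UNIV. W c k p * (\<Sum>d\<in>UNIV. W d l p * (\<Sum>a\<in>UNIV. W a i p * (D d * curv a b c d)))))"
proof -
  have lin: "(\<Sum>m\<in>UNIV. x m * (\<Sum>c\<in>UNIV. \<Sum>d\<in>UNIV. S c d * E d m p))
     = (\<Sum>c\<in>UNIV. \<Sum>d\<in>UNIV. S c d * (\<Sum>m\<in>UNIV. x m * E d m p))" for x S
    unfolding sum_distrib_left by (rule trans[OF sum_rotate3]) (simp add: mult_ac)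
  have "riem g i j k l p = (\<Sum>m\<in>UNIV. metric_comp g l m p * (\<Sum>c\<in>UNIV. \<Sum>d\<in>UNIV. (\<Sum>a\<in>UNIV. \<Sum>b\<in>UNIV. curv a b c d * W a i p * W b j p) * W c k p * E d m p))"
    unfolding riem_def riem_up_frame ..
  also have "\<dots> = (\<Sum>c\<in>UNIV. \<Sum>d\<in>UNIV. (\<Sum>a\<in>UNIV. \<Sum>b\<in>UNIV. curv a b c d * W a i p * W b j p) * W c k p * (\<Sum>m\<in>UNIV. metric_comp g l m p * E d m p))"
    by (rule lin)
  also have "\<dots> = (\<Sum>c\<in>UNIV. \<Sum>d\<in>UNIV. \<Sum>a\<in>UNIV. \<Sum>b\<in>UNIV. W b j p * (W c k p * (W d l p * (W a i p * (D d * curv a b c d)))))"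
    unfolding g_comp flat by (simp add: sum_distrib_left sum_distrib_right mult_ac)
  also have "\<dots> = (\<Sum>c\<in>UNIV. \<Sum>d\<in>UNIV. \<Sum>b\<in>UNIV. \<Sum>a\<in>UNIV. W b j p * (W c k p * (W d l p * (W a i p * (D d * curv a b c d)))))"
    by (rule sum.cong[OF refl], rule sum.cong[OF refl], rule sum.swap)
  also have "\<dots> = (\<Sum>b\<in>UNIV. \<Sum>c\<in>UNIV. \<Sum>d\<in>UNIV. \<Sum>a\<in>UNIV. W b j p * (W c k p * (W d l p * (W a i p * (D d * curv a b c d)))))"
    by (rule sum_rotate3[symmetric])
  finally show ?thesis by (simp only: sum_distrib_left)
qed

text \<open>For the inverse metric the dual forms are orthogonal with squared lengths
  \<open>1 / D b\<close>, so a double contraction collapses to a single sum.\<close>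

lemma inv_contract:
  "(\<Sum>k\<in>UNIV. \<Sum>q\<in>UNIV. metric_inv_comp g k q p * (\<Sum>b\<in>UNIV. W b k p * f b) * (\<Sum>b\<in>UNIV. W b q p * h b))
    = (\<Sum>b\<in>UNIV. f b * h b / D b)"
proof -
  have factor: "(\<Sum>q\<in>UNIV. M q * x * H q) = x * (\<Sum>q\<in>UNIV. M q * H q)" for M H :: "'n \<Rightarrow> real" and x
    by (simp add: sum_distrib_left mult_ac)
  have "(\<Sum>q\<in>UNIV. metric_inv_comp g k q p * (\<Sum>b\<in>UNIV. W b q p * h b)) = (\<Sum>b\<in>UNIV. E b k p / D b * h b)" for k
    unfolding metric_inv_comp_eq contract_sharp
    using contract[of h p] by (simp add: mult_ac)
  then have "(\<Sum>k\<in>UNIV. \<Sum>q\<in>UNIV. metric_inv_comp g k q p * (\<Sum>b\<in>UNIV. W b k p * f b) * (\<Sum>b\<in>UNIV. W b q p * h b))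
     = (\<Sum>k\<in>UNIV. (\<Sum>b\<in>UNIV. W b k p * f b) * (\<Sum>b\<in>UNIV. E b k p / D b * h b))"
    unfolding factor by simp
  also have "\<dots> = (\<Sum>b\<in>UNIV. h b / D b * (\<Sum>k\<in>UNIV. E b k p * (\<Sum>b\<in>UNIV. W b k p * f b)))"
    unfolding sum_distrib_left[of "\<Sum>b\<in>UNIV. W b _ p * f b"]
    by (rule trans[OF sum.swap]) (simp add: sum_distrib_left sum_divide_distrib mult_ac)
  finally show ?thesis unfolding contract_frame by (simp add: mult_ac)
qed

lemma riem_sq_comp_frame:
  "riem_sq_comp g i j x = (\<Sum>a\<in>UNIV. \<Sum>a'\<in>UNIV. curv_sq a a' * W a i x * W a' j x)"
proof -
  let ?H = "\<lambda>k p. metric_inv_comp g k p x"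
  \<comment> \<open>\<open>A\<close>, \<open>A1\<close>, \<open>A2\<close> are the layers of
    \<open>riem_frame\<close> from the inside out. Each of \<open>c1\<close>, \<open>c2\<close>,
    \<open>c3\<close> removes one layer from both curvature factors.\<close>
  define A where "A b c d i = (\<Sum>a\<in>UNIV. W a i x * (D d * curv a b c d))" for b c d i
  define A1 where "A1 b c m i = (\<Sum>d\<in>UNIV. W d m x * A b c d i)" for b c m i
  define A2 where "A2 b l m i = (\<Sum>c\<in>UNIV. W c l x * A1 b c m i)" for b l m i
  have R: "riem g i k l m x = (\<Sum>b\<in>UNIV. W b k x * A2 b l m i)" for i k l m
    unfolding riem_frame A_def A1_def A2_def ..
  have c1: "(\<Sum>k\<in>UNIV. \<Sum>p\<in>UNIV. ?H k p * riem g i k l m x * riem g j p q r x) = (\<Sum>b\<in>UNIV. A2 b l m i * A2 b q r j / D b)" for l m q r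
    unfolding R by (rule inv_contract)
  have c2: "(\<Sum>l\<in>UNIV. \<Sum>q\<in>UNIV. ?H l q * A2 b l m i * A2 b q r j) = (\<Sum>c\<in>UNIV. A1 b c m i * A1 b c r j / D c)" for b m r
    unfolding A2_def by (rule inv_contract)
  have c3: "(\<Sum>m\<in>UNIV. \<Sum>r\<in>UNIV. ?H m r * A1 b c m i * A1 b c r j) = (\<Sum>d\<in>UNIV. A b c d i * A b c d j / D d)" for b c
    unfolding A1_def by (rule inv_contract)
  have "riem_sq_comp g i j x = (\<Sum>m\<in>UNIV. \<Sum>r\<in>UNIV. \<Sum>l\<in>UNIV. \<Sum>q\<in>UNIV. \<Sum>k\<in>UNIV. \<Sum>p\<in>UNIV.
      ?H m r * (?H l q * (?H k p * riem g i k l m x * riem g j p q r x)))"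
    unfolding riem_sq_comp_def by (rule trans[OF sum_regroup6]) (simp only: mult_ac)
  also have "\<dots> = (\<Sum>m\<in>UNIV. \<Sum>r\<in>UNIV. \<Sum>l\<in>UNIV. \<Sum>q\<in>UNIV. \<Sum>b\<in>UNIV. ?H m r * (?H l q * (A2 b l m i * A2 b q r j / D b)))"
    by (simp only: sum_distrib_left[symmetric] c1)
  also have "\<dots> = (\<Sum>m\<in>UNIV. \<Sum>r\<in>UNIV. \<Sum>b\<in>UNIV. \<Sum>l\<in>UNIV. \<Sum>q\<in>UNIV. ?H m r / D b * (?H l q * A2 b l m i * A2 b q r j))"
    by (rule sum.cong[OF refl], rule sum.cong[OF refl], rule trans[OF sum_rotate3[symmetric]])
       (simp add: sum_distrib_left mult_ac)
  also have "\<dots> = (\<Sum>m\<in>UNIV. \<Sum>r\<in>UNIV. \<Sum>b\<in>UNIV. \<Sum>c\<in>UNIV. ?H m r / D b * (A1 b c m i * A1 b c r j / D c))"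
    by (simp only: sum_distrib_left[symmetric] c2)
  also have "\<dots> = (\<Sum>b\<in>UNIV. \<Sum>c\<in>UNIV. \<Sum>m\<in>UNIV. \<Sum>r\<in>UNIV. 1 / (D b * D c) * (?H m r * A1 b c m i * A1 b c r j))"
    by (rule trans[OF sum.cong[OF refl sum_rotate3] trans[OF sum_rotate3]]) (simp add: mult_ac)
  also have "\<dots> = (\<Sum>b\<in>UNIV. \<Sum>c\<in>UNIV. \<Sum>d\<in>UNIV. 1 / (D b * D c) * (A b c d i * A b c d j / D d))"
    by (simp only: sum_distrib_left[symmetric] c3)
  also have "\<dots> = (\<Sum>b\<in>UNIV. \<Sum>c\<in>UNIV. \<Sum>d\<in>UNIV. \<Sum>a\<in>UNIV. \<Sum>a'\<in>UNIV.
       (D d * curv a b c d) * (D d * curv a' b c d) / (D b * D c * D d) * W a i x * W a' j x)"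
    unfolding A_def sum_product divide_inverse inverse_mult_distrib
    by (simp only: sum_distrib_left sum_distrib_right mult_ac mult_1_left)
  also have "\<dots> = (\<Sum>a\<in>UNIV. \<Sum>a'\<in>UNIV. \<Sum>b\<in>UNIV. \<Sum>c\<in>UNIV. \<Sum>d\<in>UNIV.
       (D d * curv a b c d) * (D d * curv a' b c d) / (D b * D c * D d) * W a i x * W a' j x)"
    by (rule sym, rule trans[OF sum.cong[OF refl sum_rotate4]], rule sum_rotate4)
  finally show ?thesis
    unfolding frame_curv_sq_def sum_distrib_right .
qed

end

section \<open>Curvature of diagonal metrics with the brackets of E(1,1)\<close>

definition e11_const :: "3 \<Rightarrow> 3 \<Rightarrow> 3 \<Rightarrow> real" where
  "e11_const a b c = (if (a, b, c) \<in> {(2,3,1), (2,1,3)} then 1 else if (a, b, c) \<in> {(3,2,1), (1,2,3)} then - 1 else 0)"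

text \<open>Sectional curvatures of the planes spanned by two frame fields. The last case is the
  plane of \<open>e 1\<close> and \<open>e 3\<close>; it also supplies a default for
  \<open>a = b\<close>, where the difference of deltas in \<open>e11_curv\<close> is zero.\<close>

definition e11_sec :: "(3 \<Rightarrow> real) \<Rightarrow> 3 \<Rightarrow> 3 \<Rightarrow> real" where
  "e11_sec D a b = (if {a, b} = {1,2} then (D 1 + D 3) * (D 1 - 3 * D 3)
     else if {a, b} = {2,3} then (D 1 + D 3) * (D 3 - 3 * D 1)
     else (D 1 + D 3)\<^sup>2) / (4 * D 1 * D 2 * D 3)"

text \<open>A finite check over all index tuples: the frame planes diagonalise the curvature
  operator. The sign expresses R(X, Y) Y = K X for orthonormal X, Y with sectional curvature
  K.\<close>

lemma e11_curv:
  assumes "\<And>a. D a > 0"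
  shows "D d * frame_curv e11_const D a b c d
    = e11_sec D a b * D a * D b * ((if b = c \<and> a = d then 1 else 0) - (if a = c \<and> b = d then 1 else 0))"
proof -
  have nz: "D 1 \<noteq> 0" "D 2 \<noteq> 0" "D 3 \<noteq> 0" using assms by (metis less_irrefl)+
  have "\<forall>a b c d. D d * frame_curv e11_const D a b c d
    = e11_sec D a b * D a * D b * ((if b = c \<and> a = d then 1 else 0) - (if a = c \<and> b = d then 1 else 0))"
    unfolding forall_3 frame_curv_def frame_conn_def sum_3 
    using nz
    by (simp add: e11_const_def e11_sec_def doubleton_eq_iff field_simps power2_eq_square)
  then show ?thesis by blast
qed

text \<open>The eigenvalue of \<open>RG_hat\<close> on \<open>e a\<close>. In the squared curvature
  every plane through \<open>e a\<close> counts twice, once for each order of the last two indices,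
  so the factor alpha/2 of the flow becomes alpha.\<close>

definition e11_rho :: "real \<Rightarrow> (3 \<Rightarrow> real) \<Rightarrow> 3 \<Rightarrow> real" where
  "e11_rho \<alpha> D a = - 2 * (\<Sum>b\<in>UNIV - {a}. e11_sec D a b) - \<alpha> * (\<Sum>b\<in>UNIV - {a}. (e11_sec D a b)\<^sup>2)"

lemma e11_sec_sym: "e11_sec D a b = e11_sec D b a"
  by (simp add: e11_sec_def insert_commute)

lemma sum_remove_3: 
  fixes f :: "3 \<Rightarrow> real"
  shows "(\<Sum>b\<in>UNIV - {a}. f b) = (\<Sum>b\<in>UNIV. f b) - f a"
  by (simp add: sum_diff1)

lemma e11_ricci:
  assumes "\<And>a. D a > 0"
  shows "(\<Sum>a\<in>UNIV. frame_curv e11_const D a b c a)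
    = (if b = c then D b * (\<Sum>a\<in>UNIV - {b}. e11_sec D b a) else 0)"
proof -
  have "D a * frame_curv e11_const D a b c a
      = D a * (e11_sec D b a * D b * ((if b = c then 1 else 0) - (if a = c \<and> b = a then 1 else 0)))" for a
    unfolding e11_curv[of D, OF assms] by (simp add: e11_sec_sym[of D a b])
  then have "frame_curv e11_const D a b c a
      = e11_sec D b a * D b * ((if b = c then 1 else 0) - (if a = c \<and> b = a then 1 else 0))" for a
    using assms[of a] by (metis less_irrefl mult_left_cancel)
  then have "frame_curv e11_const D a b c a
      = (if b = c then D b * e11_sec D b a - (if a = b then D b * e11_sec D b b else 0) else 0)" for a
    by auto
  then show ?thesis
    by (simp add: sum_remove_3 sum_subtractf sum_distrib_left right_diff_distrib)
qed

text \<open>For fixed b, c, d at most one a gives a non-zero curvature component, which kills the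
  off-diagonal entries.\<close>

lemma e11_curv_sq:
  assumes pos: "\<And>a. D a > 0"
  shows "frame_curv_sq e11_const D a a' = (if a = a' then 2 * D a * (\<Sum>b\<in>UNIV - {a}. (e11_sec D a b)\<^sup>2) else 0)"
proof -
  have nz: "D a \<noteq> 0" for a using pos[of a] by simp
  define k where "k = e11_sec D"
  define \<delta> where "\<delta> a b c d = (if b = c \<and> a = d then 1 else 0) - (if a = c \<and> b = d then 1 else 0 :: real)" for a b c d :: 3
  have e: "\<delta> a b c d * \<delta> a' b c d = 0" if "a \<noteq> a'" for a a' b c d
    using that unfolding \<delta>_def
    by (cases "b = c"; cases "a = d"; cases "a' = d"; cases "a = c"; cases "a' = c"; cases "b = d") simp_all
  have dd: "D a * D b * \<delta> a b c d = D c * D d * \<delta> a b c d" for a b c d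
    unfolding \<delta>_def by (cases "b = c"; cases "a = d"; cases "a = c"; cases "b = d") simp_all
  have c: "D d * frame_curv e11_const D a b c d = k a b * (D a * D b * \<delta> a b c d)" for a b c d
    unfolding e11_curv[of D, OF pos] k_def \<delta>_def by (simp only: mult_ac)
  \<comment> \<open>\<open>dd\<close> rewrites the weight of the primed factor only: its
    \<open>D c * D d\<close> and the \<open>D b\<close> of the other factor cancel the denominator
    and leave \<open>D a\<close>.\<close>
  have "(D d * frame_curv e11_const D a b c d) * (D d * frame_curv e11_const D a' b c d) / (D b * D c * D d)
     = (k a b * k a' b * D a) * (\<delta> a b c d * \<delta> a' b c d)" for b c d
    unfolding c dd[of a'] using nz[of b] nz[of c] nz[of d] by (simp add: field_simps)
  also have "(k a b * k a' b * D a) * (\<delta> a b c d * \<delta> a' b c d) = (if a = a' then (k a b)\<^sup>2 * D a else 0) * (\<delta> a b c d * \<delta> a b c d)" for b c d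
    using e[of a a' b c d] by (auto simp: power2_eq_square)
  finally have *: "(D d * frame_curv e11_const D a b c d) * (D d * frame_curv e11_const D a' b c d) / (D b * D c * D d)
     = (if a = a' then (k a b)\<^sup>2 * D a else 0) * (\<delta> a b c d * \<delta> a b c d)" for b c d .
  have "\<forall>a b. (\<Sum>c\<in>UNIV. \<Sum>d\<in>UNIV. \<delta> a b c d * \<delta> a b c d) = (if a = b then 0 else 2)"
    unfolding forall_3 sum_3 by (simp add: \<delta>_def)
  then have sq: "(\<Sum>c\<in>UNIV. \<Sum>d\<in>UNIV. \<delta> a b c d * \<delta> a b c d) = (if a = b then 0 else 2)" for b
    by blast
  show ?thesis
    unfolding frame_curv_sq_def sum_remove_3 k_def[symmetric] * sum_distrib_left[symmetric] sq
    unfolding sum_3 using exhaust_3[of a] by (auto simp: algebra_simps)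
qed

section \<open>The soliton equations in A and B\<close>

lemma e11_rho_eq:
  fixes D :: "3 \<Rightarrow> real"
  defines "K \<equiv> (D 1 + D 3) / (4 * D 1 * D 2 * D 3)"
  shows "e11_rho \<alpha> D 2 = K * (D 1 + D 3) * 4 - \<alpha> * K\<^sup>2 * ((D 1 - 3 * D 3)\<^sup>2 + (D 3 - 3 * D 1)\<^sup>2)"
    and "e11_rho \<alpha> D 1 = - 4 * K * (D 1 - D 3) - \<alpha> * K\<^sup>2 * ((D 1 - 3 * D 3)\<^sup>2 + (D 1 + D 3)\<^sup>2)"
    and "e11_rho \<alpha> D 3 = 4 * K * (D 1 - D 3) - \<alpha> * K\<^sup>2 * ((D 3 - 3 * D 1)\<^sup>2 + (D 1 + D 3)\<^sup>2)"
proof -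
  have s: "e11_sec D 1 2 = K * (D 1 - 3 * D 3)" "e11_sec D 2 1 = K * (D 1 - 3 * D 3)"
    "e11_sec D 2 3 = K * (D 3 - 3 * D 1)" "e11_sec D 3 2 = K * (D 3 - 3 * D 1)"
    "e11_sec D 1 3 = K * (D 1 + D 3)" "e11_sec D 3 1 = K * (D 1 + D 3)"
    by (simp_all add: e11_sec_def K_def doubleton_eq_iff power2_eq_square)
  show "e11_rho \<alpha> D 2 = K * (D 1 + D 3) * 4 - \<alpha> * K\<^sup>2 * ((D 1 - 3 * D 3)\<^sup>2 + (D 3 - 3 * D 1)\<^sup>2)"
    "e11_rho \<alpha> D 1 = - 4 * K * (D 1 - D 3) - \<alpha> * K\<^sup>2 * ((D 1 - 3 * D 3)\<^sup>2 + (D 1 + D 3)\<^sup>2)"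
    "e11_rho \<alpha> D 3 = 4 * K * (D 1 - D 3) - \<alpha> * K\<^sup>2 * ((D 3 - 3 * D 1)\<^sup>2 + (D 1 + D 3)\<^sup>2)"
    unfolding e11_rho_def sum_remove_3 sum_3 s by (simp_all add: power2_eq_square algebra_simps)
qed

lemma e11_soliton_equations:
  assumes "A > 0" "B > 0" and D: "D 1 = A" "D 2 = B" "D 3 = 1"
  shows "e11_rho \<alpha> D 2 = 0 \<and> e11_rho \<alpha> D 1 = e11_rho \<alpha> D 3 \<longleftrightarrow>
     (A = 1 \<and> \<alpha> = 2 * B) \<or> (A \<in> {1/3, 3} \<and> \<alpha> = 3/4 * B)"
proof -
  define K where "K = (A + 1) / (4 * A * B)"
  have K: "K \<noteq> 0" "4 * A * B * K = A + 1" using assms by (auto simp: K_def)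
  note rho = e11_rho_eq[of \<alpha> D, unfolded D mult_1_right, folded K_def]
  have r2: "e11_rho \<alpha> D 2 = K * (4 * (A + 1) - \<alpha> * K * ((A - 3)\<^sup>2 + (1 - 3 * A)\<^sup>2))"
    unfolding rho by (simp add: power2_eq_square algebra_simps)
  \<comment> \<open>The difference of the squares of A - 3 and 1 - 3A is -8 (A - 1) (A + 1), so the
    Ricci part and the quadratic part share the factor A - 1.\<close>
  have r13: "e11_rho \<alpha> D 1 - e11_rho \<alpha> D 3 = 8 * K * (A - 1) * (\<alpha> * K * (A + 1) - 1)"
    unfolding rho by (simp add: power2_eq_square algebra_simps)
  have eq: "e11_rho \<alpha> D 2 = 0 \<and> e11_rho \<alpha> D 1 = e11_rho \<alpha> D 3 \<longleftrightarrow>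
     4 * (A + 1) = \<alpha> * K * ((A - 3)\<^sup>2 + (1 - 3 * A)\<^sup>2) \<and> (A = 1 \<or> \<alpha> * K * (A + 1) = 1)"
  proof -
    have "e11_rho \<alpha> D 1 = e11_rho \<alpha> D 3 \<longleftrightarrow> 8 * K * (A - 1) * (\<alpha> * K * (A + 1) - 1) = 0"
      using r13 by linarith
    then show ?thesis unfolding r2 using K by auto
  qed
  show ?thesis
  proof (cases "A = 1")
    case True
    then show ?thesis unfolding eq using K assms by (auto simp: K_def field_simps)
  next
    case False
    have "(4 * (A + 1) = \<alpha> * K * ((A - 3)\<^sup>2 + (1 - 3 * A)\<^sup>2) \<and> \<alpha> * K * (A + 1) = 1)
       \<longleftrightarrow> A \<in> {1/3, 3} \<and> \<alpha> * K * (A + 1) = 1"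
    proof (cases "\<alpha> * K * (A + 1) = 1")
      case True
      then have ak: "\<alpha> * K = 1 / (A + 1)" using assms by (simp add: field_simps)
      \<comment> \<open>After clearing A + 1 the two sides differ by 2 (3 A^2 - 10 A + 3), which is
        the stated product up to the factor 2.\<close>
      have "4 * (A + 1) = \<alpha> * K * ((A - 3)\<^sup>2 + (1 - 3 * A)\<^sup>2) \<longleftrightarrow> (A - 3) * (3 * A - 1) = 0"
        unfolding ak using assms by (simp add: field_simps power2_eq_square) (auto simp: algebra_simps)
      then show ?thesis using True by auto
    qed auto
    also have "\<dots> \<longleftrightarrow> A \<in> {1/3, 3} \<and> \<alpha> = 3/4 * B"
    proof -
      \<comment> \<open>For both values of A the factor K (A + 1) equals 4 / (3 B).\<close>
      have "\<alpha> * K * (A + 1) = 1 \<longleftrightarrow> \<alpha> = 3/4 * B" if "A = 1/3 \<or> A = 3"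
        using that
      proof
        assume A: "A = 1/3"
        show ?thesis unfolding K_def A using \<open>B > 0\<close> by (auto simp: field_simps)
      next
        assume A: "A = 3"
        show ?thesis unfolding K_def A using \<open>B > 0\<close> by (auto simp: field_simps)
      qed
      then show ?thesis by blast
    qed
    finally show ?thesis unfolding eq using False by auto
  qed
qed

text \<open>Numerator and denominator both have degree two in \<open>(D 1, D 3)\<close>. This keeps
  the eigenvalues constant along the solution below, whose coefficients then obey a linear
  equation.\<close>

lemma e11_sec_scale:
  assumes "u \<noteq> 0" "D' 1 = u * D 1" "D' 2 = D 2" "D' 3 = u * D 3"
  shows "e11_sec D' a b = e11_sec D a b"
proof -
  have *: "(u * x + u * y) * (u * z) / (4 * (u * x) * v * (u * y)) = (x + y) * z / (4 * x * v * y)" for x y z v :: real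
    using assms(1) by (simp flip: distrib_left)
  show ?thesis
    unfolding e11_sec_def assms(2-4) power2_eq_square
    using *[of "D 1" "D 3" "D 1 - 3 * D 3" "D 2"] *[of "D 1" "D 3" "D 3 - 3 * D 1" "D 2"]
      *[of "D 1" "D 3" "D 1 + D 3" "D 2"]
    by (simp add: right_diff_distrib distrib_left mult.left_commute)
qed

section \<open>Smooth maps\<close>

lemma Ck_on_SucI:
  assumes "\<And>x. x \<in> S \<Longrightarrow> (f has_derivative f' x) (at x within S)" "\<And>v. Ck_on k S (\<lambda>x. f' x v)"
  shows "Ck_on (Suc k) S f"
  using assms by auto

lemma Ck_on_SucE:
  assumes "Ck_on (Suc k) S f"
  obtains f' where "\<And>x. x \<in> S \<Longrightarrow> (f has_derivative f' x) (at x within S)" "\<And>v. Ck_on k S (\<lambda>x. f' x v)"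
  using assms by auto

text \<open>Derivatives of products and exponentials contain the original functions, known to order
  k + 1, where the induction asks for order k.\<close>

lemma Ck_on_Suc_imp: "Ck_on (Suc k) S f \<Longrightarrow> Ck_on k S f"
proof (induction k arbitrary: f)
  case 0
  then obtain f' where "\<And>x. x \<in> S \<Longrightarrow> (f has_derivative f' x) (at x within S)"
    using that by (rule Ck_on_SucE)
  then have "continuous_on S f" by (rule has_derivative_continuous_on)
  then show ?case by simp
next
  case (Suc k)
  from Suc.prems obtain f' where f': "\<And>x. x \<in> S \<Longrightarrow> (f has_derivative f' x) (at x within S)"
    "\<And>v. Ck_on (Suc k) S (\<lambda>x. f' x v)"
    using that by (rule Ck_on_SucE)
  show ?case by (rule Ck_on_SucI[OF f'(1) Suc.IH[OF f'(2)]])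
qed

lemma Ck_on_const: "Ck_on k S (\<lambda>x. c)"
proof (induction k arbitrary: c)
  case (Suc k)
  show ?case by (rule Ck_on_SucI[OF has_derivative_const Suc])
qed simp

lemma Ck_on_bounded_linear:
  assumes "bounded_linear f"
  shows "Ck_on k S f"
proof (cases k)
  case 0
  then show ?thesis using linear_continuous_on[OF assms] by simp
next
  case (Suc n)
  show ?thesis
    unfolding Suc by (rule Ck_on_SucI[OF bounded_linear_imp_has_derivative[OF assms] Ck_on_const])
qed

lemma Ck_on_add:
  assumes "Ck_on k S f" "Ck_on k S h"
  shows "Ck_on k S (\<lambda>x. f x + h x)"
  using assms
proof (induction k arbitrary: f h)
  case 0
  then show ?case by (auto intro: continuous_on_add)
next
  case (Suc k)
  obtain f' where f': "\<And>x. x \<in> S \<Longrightarrow> (f has_derivative f' x) (at x within S)" "\<And>v. Ck_on k S (\<lambda>x. f' x v)"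
    using Suc.prems(1) that by (rule Ck_on_SucE)
  obtain h' where h': "\<And>x. x \<in> S \<Longrightarrow> (h has_derivative h' x) (at x within S)" "\<And>v. Ck_on k S (\<lambda>x. h' x v)"
    using Suc.prems(2) that by (rule Ck_on_SucE)
  show ?case by (rule Ck_on_SucI[OF has_derivative_add[OF f'(1) h'(1)] Suc.IH[OF f'(2) h'(2)]])
qed

lemma Ck_on_bilinear:
  assumes B: "bounded_bilinear B" and "Ck_on k S f" "Ck_on k S h"
  shows "Ck_on k S (\<lambda>x. B (f x) (h x))"
  using assms(2,3)
proof (induction k arbitrary: f h)
  case 0
  then show ?case by (auto intro: bounded_bilinear.continuous_on[OF B])
next
  case (Suc k)
  obtain f' where f': "\<And>x. x \<in> S \<Longrightarrow> (f has_derivative f' x) (at x within S)" "\<And>v. Ck_on k S (\<lambda>x. f' x v)"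
    using Suc.prems(1) that by (rule Ck_on_SucE)
  obtain h' where h': "\<And>x. x \<in> S \<Longrightarrow> (h has_derivative h' x) (at x within S)" "\<And>v. Ck_on k S (\<lambda>x. h' x v)"
    using Suc.prems(2) that by (rule Ck_on_SucE)
  show ?case
    by (rule Ck_on_SucI[OF bounded_bilinear.FDERIV[OF B f'(1) h'(1)] Ck_on_add[OF
        Suc.IH[OF Ck_on_Suc_imp[OF Suc.prems(1)] h'(2)] Suc.IH[OF f'(2) Ck_on_Suc_imp[OF Suc.prems(2)]]]])
qed

lemma Ck_on_exp:
  fixes f :: "'a::real_normed_vector \<Rightarrow> real"
  assumes "Ck_on k S f"
  shows "Ck_on k S (\<lambda>x. exp (f x))"
  using assms
proof (induction k)
  case 0
  then show ?case by (auto intro: continuous_on_exp)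
next
  case (Suc k)
  obtain f' where f': "\<And>x. x \<in> S \<Longrightarrow> (f has_derivative f' x) (at x within S)" "\<And>v. Ck_on k S (\<lambda>x. f' x v)"
    using Suc.prems that by (rule Ck_on_SucE)
  show ?case
    by (rule Ck_on_SucI[OF DERIV_compose_FDERIV[OF DERIV_exp f'(1)]
        Ck_on_bilinear[OF bounded_bilinear_mult f'(2) Suc.IH[OF Ck_on_Suc_imp[OF Suc.prems]]]])
qed

lemma Ck_on_linear_comp:
  assumes L: "bounded_linear L" and "Ck_on k S f"
  shows "Ck_on k S (\<lambda>x. L (f x))"
  using assms(2)
proof (induction k arbitrary: f)
  case 0
  then show ?case by (auto intro: bounded_linear.continuous_on[OF L])
next
  case (Suc k)
  obtain f' where f': "\<And>x. x \<in> S \<Longrightarrow> (f has_derivative f' x) (at x within S)" "\<And>v. Ck_on k S (\<lambda>x. f' x v)"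
    using Suc.prems that by (rule Ck_on_SucE)
  show ?case
    by (rule Ck_on_SucI[OF bounded_linear.has_derivative[OF L f'(1)] Suc.IH[OF f'(2)]])
qed

lemma smooth_on_const: "smooth_on S (\<lambda>x. c)"
  by (simp add: smooth_on_def Ck_on_const)

lemma smooth_on_bounded_linear: "bounded_linear f \<Longrightarrow> smooth_on S f"
  by (simp add: smooth_on_def Ck_on_bounded_linear)

lemma smooth_on_linear_comp: "bounded_linear L \<Longrightarrow> smooth_on S f \<Longrightarrow> smooth_on S (\<lambda>x. L (f x))"
  by (simp add: smooth_on_def Ck_on_linear_comp)

lemma smooth_on_add: "smooth_on S f \<Longrightarrow> smooth_on S h \<Longrightarrow> smooth_on S (\<lambda>x. f x + h x)"
  by (simp add: smooth_on_def Ck_on_add)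

lemma smooth_on_diff: "smooth_on S f \<Longrightarrow> smooth_on S h \<Longrightarrow> smooth_on S (\<lambda>x. f x - h x)"
  using smooth_on_add[of S f "\<lambda>x. - h x"] smooth_on_linear_comp[OF bounded_linear_minus[OF bounded_linear_ident], of S h]
  by simp

lemma smooth_on_scaleR: "smooth_on S f \<Longrightarrow> smooth_on S h \<Longrightarrow> smooth_on S (\<lambda>x. f x *\<^sub>R h x)"
  by (simp add: smooth_on_def Ck_on_bilinear[OF bounded_bilinear_scaleR])

lemma smooth_on_mult:
  fixes f h :: "'a::real_normed_vector \<Rightarrow> real"
  shows "smooth_on S f \<Longrightarrow> smooth_on S h \<Longrightarrow> smooth_on S (\<lambda>x. f x * h x)"
  by (simp add: smooth_on_def Ck_on_bilinear[OF bounded_bilinear_mult])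

lemma smooth_on_sum: "(\<And>i. i \<in> I \<Longrightarrow> smooth_on S (f i)) \<Longrightarrow> smooth_on S (\<lambda>x. \<Sum>i\<in>I. f i x)"
  by (induction I rule: infinite_finite_induct) (auto intro: smooth_on_const smooth_on_add)

lemma smooth_on_exp:
  fixes f :: "'a::real_normed_vector \<Rightarrow> real"
  shows "smooth_on S f \<Longrightarrow> smooth_on S (\<lambda>x. exp (f x))"
  by (simp add: smooth_on_def Ck_on_exp)

lemma smooth_on_sinh_cosh:
  fixes f :: "'a::real_normed_vector \<Rightarrow> real"
  assumes "smooth_on S f"
  shows smooth_on_sinh: "smooth_on S (\<lambda>x. sinh (f x))" and smooth_on_cosh: "smooth_on S (\<lambda>x. cosh (f x))"
  unfolding sinh_def cosh_def
  by (intro smooth_on_linear_comp[OF bounded_linear_scaleR_right] smooth_on_diff smooth_on_add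
      smooth_on_exp assms smooth_on_linear_comp[OF bounded_linear_minus[OF bounded_linear_ident]])+

section \<open>Left invariant fields on E(1,1)\<close>

lemma linear_axis_expansion:
  fixes f :: "real^'n::finite \<Rightarrow> 'b::real_vector"
  assumes "linear f"
  shows "f v = (\<Sum>i\<in>UNIV. v $ i *\<^sub>R f (axis i 1))"
proof -
  have "f v = f (\<Sum>i\<in>UNIV. v $ i *\<^sub>R axis i 1)"
    using basis_expansion[of v] by (simp add: scalar_mult_eq_scaleR)
  then show ?thesis by (simp add: linear_sum[OF assms] linear_scale[OF assms])
qed

section \<open>Boosts and their generator\<close>

definition swap12 :: "real^3 \<Rightarrow> real^3" where
  "swap12 v = vector [v $ 2, v $ 1, 0]"

text \<open>The exponential of s J for J = \<open>swap12\<close>, summed by means of J^3 = J. Only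
  the scalar coefficients depend on s, which makes derivatives and smoothness immediate.\<close>

definition boost :: "real \<Rightarrow> real^3 \<Rightarrow> real^3" where
  "boost s v = v + sinh s *\<^sub>R swap12 v + (cosh s - 1) *\<^sub>R swap12 (swap12 v)"

lemma swap12_simps [simp]: "swap12 v $ 1 = v $ 2" "swap12 v $ 2 = v $ 1" "swap12 v $ 3 = 0"
  by (simp_all add: swap12_def)

lemma linear_swap12: "linear swap12"
  by (rule linearI) (simp_all add: vec_eq_iff forall_3)

lemmas swap12_linear = linear_add[OF linear_swap12] linear_diff[OF linear_swap12]
  linear_scale[OF linear_swap12] linear_neg[OF linear_swap12] linear_0[OF linear_swap12]

lemma swap12_cube [simp]: "swap12 (swap12 (swap12 v)) = swap12 v"
  by (simp add: vec_eq_iff forall_3)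

lemma boost_simps [simp]: "boost s v $ 1 = cosh s * v $ 1 + sinh s * v $ 2"
  "boost s v $ 2 = sinh s * v $ 1 + cosh s * v $ 2" "boost s v $ 3 = v $ 3"
  by (simp_all add: boost_def algebra_simps)

lemma linear_boost: "linear (boost s)"
  by (rule linearI) (simp_all add: vec_eq_iff forall_3 algebra_simps)

lemma boost_0 [simp]: "boost 0 v = v"
  by (simp add: boost_def)

lemma boost_add: "boost (s + t) v = boost s (boost t v)"
  by (simp add: vec_eq_iff forall_3 sinh_add cosh_add algebra_simps)

lemma boost_cancel [simp]: "boost (- s) (boost s v) = v" "boost s (boost (- s) v) = v"
  by (simp_all flip: boost_add)

lemma swap12_boost: "swap12 (boost s v) = boost s (swap12 v)"
  by (simp add: vec_eq_iff forall_3)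

lemma has_derivative_boost:
  fixes p :: "real^3"
  shows "((\<lambda>p. boost (p $ 3) x) has_derivative (\<lambda>v. v $ 3 *\<^sub>R swap12 (boost (p $ 3) x))) (at p)"
proof -
  have p3: "((\<lambda>p::real^3. p $ 3) has_derivative (\<lambda>v. v $ 3)) (at p)"
    by (rule bounded_linear_imp_has_derivative[OF bounded_linear_vec_nth])
  have "DERIV sinh s :> cosh s" "DERIV cosh s :> sinh s" for s :: real
    using has_field_derivative_sinh[OF DERIV_ident, of s UNIV]
      has_field_derivative_cosh[OF DERIV_ident, of s UNIV] by simp_all
  note d = this[THEN DERIV_compose_FDERIV, OF p3]
  have "((\<lambda>p. sinh (p $ 3) *\<^sub>R swap12 x) has_derivative (\<lambda>v. (v $ 3 * cosh (p $ 3)) *\<^sub>R swap12 x)) (at p)"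
    by (rule has_derivative_scaleR_left[OF d(1)])
  moreover have "((\<lambda>p. (cosh (p $ 3) - 1) *\<^sub>R swap12 (swap12 x)) has_derivative
      (\<lambda>v. (v $ 3 * sinh (p $ 3)) *\<^sub>R swap12 (swap12 x))) (at p)"
    by (rule has_derivative_scaleR_left) (rule has_derivative_diff[OF d(2) has_derivative_const, simplified])
  ultimately have "((\<lambda>p. boost (p $ 3) x) has_derivative
     (\<lambda>v. 0 + (v $ 3 * cosh (p $ 3)) *\<^sub>R swap12 x + (v $ 3 * sinh (p $ 3)) *\<^sub>R swap12 (swap12 x))) (at p)"
    unfolding boost_def by (intro has_derivative_add has_derivative_const)
  moreover have "(\<lambda>v::real^3. 0 + (v $ 3 * cosh (p $ 3)) *\<^sub>R swap12 x + (v $ 3 * sinh (p $ 3)) *\<^sub>R swap12 (swap12 x))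
     = (\<lambda>v. v $ 3 *\<^sub>R swap12 (boost (p $ 3) x))"
    by (simp add: fun_eq_iff vec_eq_iff forall_3 algebra_simps)
  ultimately show ?thesis by (simp only:)
qed

lemma E11_mult_eq: "E11_mult a p = a + boost (a $ 3) p"
  by (simp add: E11_mult_def vec_eq_iff forall_3)

lemma frechet_derivative_E11_mult: "frechet_derivative (E11_mult a) (at p) = boost (a $ 3)"
proof -
  have "(E11_mult a has_derivative boost (a $ 3)) (at p)"
    unfolding E11_mult_eq[abs_def]
    using has_derivative_add[OF has_derivative_const linear_imp_has_derivative[OF linear_boost]]
    by fastforce
  then show ?thesis by (rule frechet_derivative_at[symmetric])
qed

text \<open>The unit of the group is 0, and left translation by a has the derivative
  \<open>boost (a $ 3)\<close> everywhere, so invariance transports the value at 0 to all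
  points.\<close>

lemma left_invariant_field_iff: "left_invariant_field X \<longleftrightarrow> (\<forall>p. X p = boost (p $ 3) (X 0))"
proof
  assume "left_invariant_field X"
  then have "\<forall>a p. X (E11_mult a p) = boost (a $ 3) (X p)"
    unfolding left_invariant_field_def frechet_derivative_E11_mult .
  then have "X (E11_mult p 0) = boost (p $ 3) (X 0)" for p
    by (elim allE)
  moreover have "E11_mult p 0 = p" for p
    by (simp add: E11_mult_eq linear_0[OF linear_boost])
  ultimately have "X p = boost (p $ 3) (X 0)" for p
    by (rule subst[of _ _ "\<lambda>q. X q = boost (p $ 3) (X 0)", rotated])
  then show "\<forall>p. X p = boost (p $ 3) (X 0)" by (rule allI)
next
  assume X: "\<forall>p. X p = boost (p $ 3) (X 0)"
  show "left_invariant_field X"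
    unfolding left_invariant_field_def frechet_derivative_E11_mult
  proof (intro allI)
    fix a p
    have "X (E11_mult a p) = boost (E11_mult a p $ 3) (X 0)" by (rule X[rule_format])
    also have "\<dots> = boost (a $ 3) (boost (p $ 3) (X 0))" by (simp add: E11_mult_eq boost_add)
    also have "boost (p $ 3) (X 0) = X p" by (rule X[rule_format, symmetric])
    finally show "X (E11_mult a p) = boost (a $ 3) (X p)" .
  qed
qed

lemma left_invariant_field_has_derivative:
  assumes "left_invariant_field X"
  shows "(X has_derivative (\<lambda>v. v $ 3 *\<^sub>R swap12 (X p))) (at p)"
proof -
  define x where "x = X 0"
  have "X = (\<lambda>p. boost (p $ 3) x)"
    using assms unfolding left_invariant_field_iff x_def by (intro ext) (erule spec)
  then show ?thesis by (simp only: has_derivative_boost)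
qed

text \<open>The derivative of an invariant field at p depends only on its value at p, which turns
  brackets and the Leibniz rule into linear algebra.\<close>

lemma lie_bracket_left_invariant:
  assumes "left_invariant_field X" "left_invariant_field Y"
  shows "lie_bracket X Y p = X p $ 3 *\<^sub>R swap12 (Y p) - Y p $ 3 *\<^sub>R swap12 (X p)"
  unfolding lie_bracket_def
    left_invariant_field_has_derivative[OF assms(1), THEN frechet_derivative_at, symmetric]
    left_invariant_field_has_derivative[OF assms(2), THEN frechet_derivative_at, symmetric] ..

lemma left_invariant_field_boost: "left_invariant_field X \<Longrightarrow> X p = boost (p $ 3) (X 0)"
  unfolding left_invariant_field_iff by (erule spec)

lemma left_invariant_fieldI: "(\<And>p. X p = boost (p $ 3) (X 0)) \<Longrightarrow> left_invariant_field X"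
  unfolding left_invariant_field_iff by (rule allI)

lemma left_invariant_field_scale:
  assumes "left_invariant_field X"
  shows "left_invariant_field (\<lambda>p. c *\<^sub>R X p)"
  by (rule left_invariant_fieldI, subst left_invariant_field_boost[OF assms])
     (simp only: linear_scale[OF linear_boost])

lemma left_invariant_field_diff:
  assumes "left_invariant_field X" "left_invariant_field Y"
  shows "left_invariant_field (\<lambda>p. X p - Y p)"
  by (rule left_invariant_fieldI, subst left_invariant_field_boost[OF assms(1)],
      subst left_invariant_field_boost[OF assms(2)]) (simp only: linear_diff[OF linear_boost])

lemma left_invariant_field_3:
  assumes "left_invariant_field X"
  shows "X p $ 3 = X 0 $ 3"
  by (subst left_invariant_field_boost[OF assms]) (rule boost_simps(3))

lemma smooth_on_boost:
  fixes f :: "'a::real_normed_vector \<Rightarrow> real"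
  assumes "smooth_on S f"
  shows "smooth_on S (\<lambda>x. boost (f x) v)"
  unfolding boost_def
  by (intro smooth_on_add smooth_on_scaleR smooth_on_diff smooth_on_const smooth_on_sinh smooth_on_cosh assms)

lemma smooth_on_vec_nth: "smooth_on S (\<lambda>p::real^'n::finite. p $ i)"
  by (rule smooth_on_bounded_linear[OF bounded_linear_vec_nth])

section \<open>Diagonal metrics on E(1,1)\<close>

locale e11_frame =
  fixes e :: "3 \<Rightarrow> 3 vfield" and \<omega> :: "3 \<Rightarrow> 3 oneform"
  assumes frame: "left_invariant_frame e"
    and bracket23: "lie_bracket (e 2) (e 3) = e 1"
    and bracket12: "lie_bracket (e 1) (e 2) = (\<lambda>p. - e 3 p)"
    and bracket31: "lie_bracket (e 3) (e 1) = (\<lambda>p. 0)"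
    and dual: "dual_coframe e \<omega>"
begin

section \<open>The frame and its dual forms\<close>

lemma e_left_invariant: "left_invariant_field (e i)"
  using frame by (simp add: left_invariant_frame_def)

lemma e_boost: "e i p = boost (p $ 3) (e i 0)"
  using e_left_invariant[of i] unfolding left_invariant_field_iff by (rule spec)

lemma boost_e [simp]: "boost (- p $ 3) (e i p) = e i 0"
  by (subst e_boost) simp

lemma linear_\<omega>: "linear (\<omega> i p)"
  using dual by (simp add: dual_coframe_def)

lemma \<omega>_e [simp]: "\<omega> i p (e j p) = (if i = j then 1 else 0)"
  using dual by (simp add: dual_coframe_def)

lemma bracket_e: "lie_bracket (e a) (e b) p = e a p $ 3 *\<^sub>R swap12 (e b p) - e b p $ 3 *\<^sub>R swap12 (e a p)"
  by (rule lie_bracket_left_invariant[OF e_left_invariant e_left_invariant])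

lemma span_e: "span (range (\<lambda>i. e i p)) = UNIV"
  using frame by (simp add: left_invariant_frame_def)

lemma linear_eq_on_frame:
  assumes "linear f" "linear h" "\<And>i. f (e i p) = h (e i p)"
  shows "f v = h v"
  by (rule linear_eq_on_span[OF assms(1,2), of "range (\<lambda>i. e i p)"]) (use assms(3) span_e in auto)

lemma frame_expansion: "(\<Sum>i\<in>UNIV. \<omega> i p v *\<^sub>R e i p) = v"
proof (rule linear_eq_on_frame[of "\<lambda>v. \<Sum>i\<in>UNIV. \<omega> i p v *\<^sub>R e i p" "\<lambda>v. v" p v])
  show "linear (\<lambda>v. \<Sum>i\<in>UNIV. \<omega> i p v *\<^sub>R e i p)"
    by (intro linear_compose_sum ballI linear_compose[OF linear_\<omega>, unfolded o_def] linearI)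
       (simp_all add: scaleR_left_distrib linear_add[OF linear_\<omega>] linear_scale[OF linear_\<omega>])
  show "linear (\<lambda>v::real^3. v)" by (rule linear_ident)
  show "(\<Sum>i\<in>UNIV. \<omega> i p (e j p) *\<^sub>R e i p) = e j p" for j
    by (simp add: if_distrib[of "\<lambda>x. x *\<^sub>R _"] cong: if_cong)
qed

lemma \<omega>_boost: "\<omega> i p v = \<omega> i 0 (boost (- p $ 3) v)"
  by (rule linear_eq_on_frame[of "\<omega> i p" "\<lambda>v. \<omega> i 0 (boost (- p $ 3) v)" p v])
     (auto simp: linear_\<omega> intro!: linear_compose[OF linear_boost linear_\<omega>, unfolded o_def])

text \<open>Brackets lie in the ideal of translations, where the third coordinate is zero. This
  applies to \<open>e 1\<close> and, in \<open>e3_3\<close>, to \<open>e 3\<close>; then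
  \<open>e 2\<close> must be transversal, since otherwise [\<open>e 2\<close>, \<open>e 3\<close>]
  would vanish.\<close>

lemma e1_3: "e 1 p $ 3 = 0"
proof -
  have "e 1 p $ 3 = lie_bracket (e 2) (e 3) p $ 3" by (simp only: bracket23)
  then show ?thesis unfolding bracket_e by simp
qed

lemma e3_3: "e 3 p $ 3 = 0"
proof -
  have "e 3 p $ 3 = - lie_bracket (e 1) (e 2) p $ 3" by (simp add: bracket12)
  then show ?thesis unfolding bracket_e by simp
qed

lemma e2_3: "e 2 p $ 3 = e 2 0 $ 3"
  by (subst e_boost) simp

lemma e2_3_nz: "e 2 0 $ 3 \<noteq> 0"
proof
  assume "e 2 0 $ 3 = 0"
  then have "e 1 0 = 0"
    using fun_cong[OF bracket23, of 0] e3_3[of 0] unfolding bracket_e by simp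
  then show False using \<omega>_e[of 1 0 1] linear_0[OF linear_\<omega>] by simp
qed

lemma \<omega>2: "\<omega> 2 p v = v $ 3 / e 2 0 $ 3"
  using arg_cong[OF frame_expansion[of p v], of "\<lambda>v. v $ 3"] e2_3_nz
  by (simp add: sum_3 e1_3 e3_3 e2_3[of p] field_simps)

text \<open>The matrices \<open>N i\<close> for \<open>parallel_frame\<close>: invariant fields
  depend on the third coordinate only, and along it they are differentiated by applying
  \<open>swap12\<close>.\<close>

definition swap_coeff :: "3 \<Rightarrow> 3 \<Rightarrow> 3 \<Rightarrow> real" where
  "swap_coeff i l k = (if i = 3 then swap12 (axis k 1) $ l else 0)"

definition diag_metric :: "(3 \<Rightarrow> real) \<Rightarrow> 3 tensor2" where
  "diag_metric D p v w = (\<Sum>a\<in>UNIV. D a * \<omega> a p v * \<omega> a p w)"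

lemma swap12_expand: "swap12 v $ l = (\<Sum>m\<in>UNIV. swap_coeff 3 l m * v $ m)"
  using exhaust_3[of l] by (auto simp: swap_coeff_def sum_3 axis_def)

lemma bracket_const: "lie_bracket (e a) (e b) p = (\<Sum>c\<in>UNIV. e11_const a b c *\<^sub>R e c p)"
proof -
  have skew: "lie_bracket (e a) (e b) p = - lie_bracket (e b) (e a) p" for a b
    by (simp add: bracket_e)
  have diag: "lie_bracket (e a) (e a) p = 0" for a by (simp add: bracket_e)
  have "\<forall>a b. lie_bracket (e a) (e b) p = (\<Sum>c\<in>UNIV. e11_const a b c *\<^sub>R e c p)"
    unfolding forall_3 sum_3
    using skew[of 3 2] skew[of 2 1] skew[of 1 3]
    by (simp add: diag bracket23 bracket12 bracket31 e11_const_def)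
  then show ?thesis by blast
qed

lemma parallel_frame_e:
  assumes "\<And>a. D a > 0"
  shows "parallel_frame (\<lambda>a i p. e a p $ i) (\<lambda>a i p. \<omega> a p (axis i 1)) swap_coeff e11_const D (diag_metric D)"
proof
  show "(\<Sum>i\<in>UNIV. \<omega> a p (axis i 1) * e b p $ i) = (if a = b then 1 else 0)" for a b p
    using linear_axis_expansion[OF linear_\<omega>, of a p "e b p"] by (simp add: mult_ac)
  show "(\<Sum>a\<in>UNIV. e a p $ i * \<omega> a p (axis j 1)) = (if i = j then 1 else 0)" for i j p
    using arg_cong[OF frame_expansion[of p "axis j 1"], of "\<lambda>v. v $ i"] by (simp add: mult_ac axis_def)
  show "has_partials (\<lambda>p. e a p $ i) (\<lambda>k. \<Sum>m\<in>UNIV. swap_coeff k i m * e a p $ m) p" for a i p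
  proof -
    have "((\<lambda>p. e a p $ i) has_derivative (\<lambda>v. (v $ 3 *\<^sub>R swap12 (e a p)) $ i)) (at p)"
      by (rule bounded_linear.has_derivative[OF bounded_linear_vec_nth left_invariant_field_has_derivative[OF e_left_invariant]])
    moreover have "(\<lambda>v::real^3. (v $ 3 *\<^sub>R swap12 (e a p)) $ i) = (\<lambda>v. \<Sum>k\<in>UNIV. (\<Sum>m\<in>UNIV. swap_coeff k i m * e a p $ m) * v $ k)"
      by (rule ext, subst sum_3) (simp add: swap12_expand, simp add: swap_coeff_def)
    ultimately show ?thesis by (simp add: has_partials_def)
  qed
  show "has_partials (\<lambda>p. \<omega> a p (axis i 1)) (\<lambda>k. - (\<Sum>m\<in>UNIV. \<omega> a p (axis m 1) * swap_coeff k m i)) p" for a i p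
  proof -
    \<comment> \<open>By \<open>\<omega>_boost\<close> the dual form at p is the one at 0 after the
      boost by \<open>- p $ 3\<close>; the minus sign is that of \<open>dW\<close>.\<close>
    have 1: "((\<lambda>p::real^3. - p $ 3) has_derivative (\<lambda>v. - v $ 3)) (at p)"
      by (intro derivative_intros bounded_linear.has_derivative[OF bounded_linear_vec_nth])
    have "((\<lambda>p. boost (- p $ 3) (axis i 1)) has_derivative (\<lambda>v. (- v $ 3) *\<^sub>R swap12 (boost (- p $ 3) (axis i 1)))) (at p)"
      using has_derivative_compose[OF linear_imp_has_derivative[OF linear_uminus, of "at p"] has_derivative_boost[of "axis i 1" "- p"]]
      by simp
    from bounded_linear.has_derivative[OF linear_conv_bounded_linear[THEN iffD1, OF linear_\<omega>[of a 0]] this]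
    have "((\<lambda>p. \<omega> a p (axis i 1)) has_derivative (\<lambda>v. - v $ 3 * \<omega> a p (swap12 (axis i 1)))) (at p)"
      by (simp add: linear_scale[OF linear_\<omega>] linear_neg[OF linear_\<omega>] swap12_boost flip: \<omega>_boost)
    moreover have "(\<lambda>v::real^3. - v $ 3 * \<omega> a p (swap12 (axis i 1)))
       = (\<lambda>v. \<Sum>k\<in>UNIV. - (\<Sum>m\<in>UNIV. \<omega> a p (axis m 1) * swap_coeff k m i) * v $ k)"
      by (rule ext, subst (2) sum_3, subst linear_axis_expansion[OF linear_\<omega>]) (simp add: swap_coeff_def mult_ac)
    ultimately show ?thesis by (simp add: has_partials_def)
  qed
  \<comment> \<open>The matrices commute because only the one with index 3 is non-zero.\<close>
  show "(\<Sum>m\<in>UNIV. swap_coeff i k m * swap_coeff j m l) = (\<Sum>m\<in>UNIV. swap_coeff j k m * swap_coeff i m l)" for i j k l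
    by (cases "i = 3"; cases "j = 3") (simp_all add: swap_coeff_def)
  show "(\<Sum>i\<in>UNIV. \<Sum>k\<in>UNIV. e a p $ i * e b p $ k * (swap_coeff i l k - swap_coeff k l i)) = (\<Sum>c\<in>UNIV. e11_const a b c * e c p $ l)" for a b l p
  proof -
    have "(\<Sum>i\<in>UNIV. \<Sum>k\<in>UNIV. e a p $ i * e b p $ k * (swap_coeff i l k - swap_coeff k l i)) = lie_bracket (e a) (e b) p $ l"
      unfolding bracket_e by (simp add: swap12_expand sum_3) (simp add: swap_coeff_def algebra_simps)
    then show ?thesis unfolding bracket_const by simp
  qed
  show "e11_const a b c = - e11_const b a c" for a b c
    by (auto simp: e11_const_def)
  show "D a \<noteq> 0" for a using assms[of a] by simp
  show "metric_comp (diag_metric D) i j p = (\<Sum>b\<in>UNIV. D b * \<omega> b p (axis i 1) * \<omega> b p (axis j 1))" for i j p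
    by (simp add: metric_comp_def diag_metric_def)
qed

section \<open>The flow operator on diagonal metrics\<close>

lemma diag_tensor_expansion:
  "(\<Sum>i\<in>UNIV. \<Sum>j\<in>UNIV. (\<Sum>b\<in>UNIV. r b * \<omega> b p (axis i 1) * \<omega> b p (axis j 1)) * v $ i * w $ j)
     = (\<Sum>b\<in>UNIV. r b * \<omega> b p v * \<omega> b p w)"
proof -
  have "(\<Sum>i\<in>UNIV. \<Sum>j\<in>UNIV. (\<Sum>b\<in>UNIV. r b * \<omega> b p (axis i 1) * \<omega> b p (axis j 1)) * v $ i * w $ j)
     = (\<Sum>b\<in>UNIV. \<Sum>i\<in>UNIV. \<Sum>j\<in>UNIV. r b * (v $ i * \<omega> b p (axis i 1)) * (w $ j * \<omega> b p (axis j 1)))"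
    by (rule sym, rule trans[OF sum_rotate3]) (simp add: sum_distrib_left sum_distrib_right mult_ac)
  also have "\<dots> = (\<Sum>b\<in>UNIV. r b * (\<Sum>i\<in>UNIV. v $ i * \<omega> b p (axis i 1)) * (\<Sum>j\<in>UNIV. w $ j * \<omega> b p (axis j 1)))"
    by (simp add: sum_distrib_left sum_distrib_right mult_ac)
  finally show ?thesis
    using linear_axis_expansion[OF linear_\<omega>, of _ p v] linear_axis_expansion[OF linear_\<omega>, of _ p w] by simp
qed

lemma RG_diag_metric:
  assumes "\<And>a. D a > 0"
  shows "RG \<alpha> (diag_metric D) p v w = (\<Sum>a\<in>UNIV. e11_rho \<alpha> D a * D a * \<omega> a p v * \<omega> a p w)"
proof -
  interpret parallel_frame "\<lambda>a i p. e a p $ i" "\<lambda>a i p. \<omega> a p (axis i 1)" swap_coeff e11_const D "diag_metric D"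
    by (rule parallel_frame_e[OF assms])
  have delta: "(\<Sum>a\<in>UNIV. \<Sum>a'\<in>UNIV. (if a = a' then f a else 0) * x a * y a') = (\<Sum>a\<in>UNIV. f a * x a * y a)"
    for f x y :: "3 \<Rightarrow> real"
    by (simp add: sum_3)
  have 1: "ricci (diag_metric D) p v w = (\<Sum>a\<in>UNIV. (D a * (\<Sum>b\<in>UNIV - {a}. e11_sec D a b)) * \<omega> a p v * \<omega> a p w)"
    unfolding ricci_def ricci_comp_frame e11_ricci[of D, OF assms] delta by (rule diag_tensor_expansion)
  have 2: "riem_sq (diag_metric D) p v w = (\<Sum>a\<in>UNIV. (2 * D a * (\<Sum>b\<in>UNIV - {a}. (e11_sec D a b)\<^sup>2)) * \<omega> a p v * \<omega> a p w)"
    unfolding riem_sq_def riem_sq_comp_frame e11_curv_sq[of D, OF assms] delta by (rule diag_tensor_expansion)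
  show ?thesis
    unfolding RG_def 1 2 e11_rho_def sum_3 by (simp add: algebra_simps)
qed

lemma \<omega>_eq_0: "(\<And>a. \<omega> a p v = 0) \<Longrightarrow> v = 0"
  using frame_expansion[of p v] by simp

lemma \<omega>_cong: "p $ 3 = q $ 3 \<Longrightarrow> \<omega> a p v = \<omega> a q v"
  by (simp add: \<omega>_boost[of a p] \<omega>_boost[of a q])

lemma \<omega>_sum: "\<omega> a p (\<Sum>b\<in>UNIV. c b *\<^sub>R e b p) = c a"
  by (simp add: linear_sum[OF linear_\<omega>] linear_scale[OF linear_\<omega>] if_distrib cong: if_cong)

lemma smooth_on_\<omega>: "smooth_on S (\<lambda>p. \<omega> a p v)"
proof -
  have "smooth_on S (\<lambda>p::real^3. \<omega> a 0 (boost (- p $ 3) v))"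
    by (intro smooth_on_linear_comp[OF linear_conv_bounded_linear[THEN iffD1, OF linear_\<omega>]] smooth_on_boost
        smooth_on_linear_comp[OF bounded_linear_minus[OF bounded_linear_ident]] smooth_on_vec_nth)
  then show ?thesis by (simp flip: \<omega>_boost)
qed

lemma riemannian_diag_metric:
  assumes "\<And>a. D a > 0"
  shows "riemannian_metric (diag_metric D)"
  unfolding riemannian_metric_def
proof (intro conjI allI impI)
  fix p v w
  show "bilinear (diag_metric D p)"
    unfolding bilinear_def diag_metric_def
    by (auto intro!: linearI simp: linear_add[OF linear_\<omega>] linear_scale[OF linear_\<omega>] sum.distrib
        sum_distrib_left algebra_simps)
  show "diag_metric D p v w = diag_metric D p w v"
    by (simp add: diag_metric_def mult_ac)
  show "smooth_on UNIV (\<lambda>p. diag_metric D p v w)"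
    unfolding diag_metric_def by (intro smooth_on_sum smooth_on_mult smooth_on_const smooth_on_\<omega>)
next
  fix p v :: "real^3"
  assume "v \<noteq> 0"
  then obtain a where "\<omega> a p v \<noteq> 0" using \<omega>_eq_0 by blast
  then have "0 < D a * \<omega> a p v * \<omega> a p v"
    using assms[of a] by (auto simp: mult.assoc zero_less_mult_iff linorder_neq_iff)
  moreover have "0 \<le> D b * \<omega> b p v * \<omega> b p v" for b
    using assms[of b] by (simp add: mult.assoc)
  ultimately show "diag_metric D p v v > 0"
    unfolding diag_metric_def by (intro sum_pos2[of UNIV a]) auto
qed

lemma left_invariant_diag_metric:
  assumes "\<And>a. D a > 0"
  shows "left_invariant_metric (diag_metric D)"
proof -
  have "\<omega> i (E11_mult a p) (boost (a $ 3) v) = \<omega> i p v" for i a p v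
    unfolding \<omega>_boost[of i "E11_mult a p"] \<omega>_boost[of i p] boost_add[symmetric]
    by (simp add: E11_mult_eq)
  then have "pullback (E11_mult a) (diag_metric D) = diag_metric D" for a
    by (simp add: fun_eq_iff pullback_def diag_metric_def frechet_derivative_E11_mult)
  then show ?thesis
    using riemannian_diag_metric[of D, OF assms] by (simp add: left_invariant_metric_def)
qed

lemma RG_hat_diag_metric:
  assumes "\<And>a. D a > 0"
  shows "RG_hat \<alpha> (diag_metric D) X p = (\<Sum>a\<in>UNIV. (e11_rho \<alpha> D a * \<omega> a p (X p)) *\<^sub>R e a p)"
  unfolding RG_hat_def
proof (rule the_equality)
  show "\<forall>w. diag_metric D p (\<Sum>a\<in>UNIV. (e11_rho \<alpha> D a * \<omega> a p (X p)) *\<^sub>R e a p) w = RG \<alpha> (diag_metric D) p (X p) w"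
    unfolding RG_diag_metric[of D, OF assms] diag_metric_def \<omega>_sum by (simp add: mult_ac)
next
  fix v
  assume v: "\<forall>w. diag_metric D p v w = RG \<alpha> (diag_metric D) p (X p) w"
  have "\<omega> a p v = e11_rho \<alpha> D a * \<omega> a p (X p)" for a
    using v[rule_format, of "e a p"] assms[of a]
    unfolding RG_diag_metric[of D, OF assms] diag_metric_def
    by (simp add: if_distrib cong: if_cong)
  then show "v = (\<Sum>a\<in>UNIV. (e11_rho \<alpha> D a * \<omega> a p (X p)) *\<^sub>R e a p)"
    using frame_expansion[of p v] by simp
qed

section \<open>The derivation condition\<close>

lemma steady_diag_metric_iff:
  assumes pos: "\<And>a. D a > 0"
  shows "steady_algebraic_soliton \<alpha> (diag_metric D)
    \<longleftrightarrow> e11_rho \<alpha> D 2 = 0 \<and> e11_rho \<alpha> D 1 = e11_rho \<alpha> D 3"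
proof -
  let ?\<rho> = "e11_rho \<alpha> D"
  define F where "F X p = (\<Sum>a\<in>UNIV. (?\<rho> a * \<omega> a p (X p)) *\<^sub>R e a p)" for X :: "3 vfield" and p
  have iff: "steady_algebraic_soliton \<alpha> (diag_metric D) \<longleftrightarrow> derivation_E11 F"
    unfolding steady_algebraic_soliton_def algebraic_soliton_def RG_hat_diag_metric[of D, OF pos] F_def[abs_def]
    using left_invariant_diag_metric[of D, OF pos] by simp
  have Fe: "F (e a) = (\<lambda>p. ?\<rho> a *\<^sub>R e a p)" for a
    by (simp add: fun_eq_iff F_def if_distrib[of "\<lambda>x. x *\<^sub>R _"] if_distrib[of "(*) _"] cong: if_cong)
  have scale: "lie_bracket (\<lambda>p. c *\<^sub>R e a p) (e b) p = c *\<^sub>R lie_bracket (e a) (e b) p"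
    "lie_bracket (e a) (\<lambda>p. c *\<^sub>R e b p) p = c *\<^sub>R lie_bracket (e a) (e b) p" for a b c p
    using lie_bracket_left_invariant[OF left_invariant_field_scale[OF e_left_invariant, of c a] e_left_invariant[of b], of p]
      lie_bracket_left_invariant[OF e_left_invariant[of a] left_invariant_field_scale[OF e_left_invariant, of c b], of p]
    by (simp_all add: bracket_e swap12_linear scaleR_right_diff_distrib mult.commute)
  have "?\<rho> 2 = 0 \<and> ?\<rho> 1 = ?\<rho> 3" if "derivation_E11 F"
  proof -
    have leib: "F (lie_bracket (e a) (e b)) = (\<lambda>p. (?\<rho> a + ?\<rho> b) *\<^sub>R lie_bracket (e a) (e b) p)" for a b
      using that e_left_invariant unfolding derivation_E11_def lie_algebra_E11_def
      by (simp add: Fe scale scaleR_left_distrib)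
    \<comment> \<open>The two non-zero brackets give
      \<open>\<rho>\<^sub>1 = \<rho>\<^sub>2 + \<rho>\<^sub>3\<close> and
      \<open>\<rho>\<^sub>3 = \<rho>\<^sub>1 + \<rho>\<^sub>2\<close>; together they force
      \<open>\<rho>\<^sub>2 = 0\<close>.\<close>
    have "?\<rho> 1 *\<^sub>R e 1 0 = (?\<rho> 2 + ?\<rho> 3) *\<^sub>R e 1 0"
      using fun_cong[OF leib[of 2 3], of 0] by (simp add: bracket23 Fe)
    from arg_cong[OF this, of "\<omega> 1 0"] have 1: "?\<rho> 1 = ?\<rho> 2 + ?\<rho> 3"
      by (simp add: linear_scale[OF linear_\<omega>])
    have "F (\<lambda>p. - e 3 p) = (\<lambda>p. - ?\<rho> 3 *\<^sub>R e 3 p)"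
      by (simp add: fun_eq_iff F_def linear_neg[OF linear_\<omega>] if_distrib[of "\<lambda>x. x *\<^sub>R _"] if_distrib[of "(*) _"] if_distrib[of uminus] cong: if_cong)
    then have "?\<rho> 3 *\<^sub>R e 3 0 = (?\<rho> 1 + ?\<rho> 2) *\<^sub>R e 3 0"
      using fun_cong[OF leib[of 1 2], of 0] by (simp add: bracket12)
    from arg_cong[OF this, of "\<omega> 3 0"] have "?\<rho> 3 = ?\<rho> 1 + ?\<rho> 2"
      by (simp add: linear_scale[OF linear_\<omega>])
    with 1 show ?thesis by simp
  qed
  moreover have "derivation_E11 F" if \<rho>: "?\<rho> 2 = 0" "?\<rho> 1 = ?\<rho> 3"
  proof -
    define d where "d = ?\<rho> 3"
    \<comment> \<open>\<open>F\<close> is d times the projection along \<open>e 2\<close> onto the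
      span of \<open>e 1\<close> and \<open>e 3\<close>. Through the third coordinate this is
      expressed without the dual forms.\<close>
    have F: "F X = (\<lambda>p. d *\<^sub>R (X p - (X p $ 3 / e 2 0 $ 3) *\<^sub>R e 2 p))" for X
    proof
      fix p
      have "X p - (X p $ 3 / e 2 0 $ 3) *\<^sub>R e 2 p = \<omega> 1 p (X p) *\<^sub>R e 1 p + \<omega> 3 p (X p) *\<^sub>R e 3 p"
        using frame_expansion[of p "X p"] \<omega>2[of p "X p"] by (simp add: sum_3 algebra_simps)
      then show "F X p = d *\<^sub>R (X p - (X p $ 3 / e 2 0 $ 3) *\<^sub>R e 2 p)"
        by (simp add: F_def sum_3 \<rho> d_def scaleR_right_distrib)
    qed
    have inv: "left_invariant_field (F X)" if "left_invariant_field X" for X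
    proof -
      have "F X = (\<lambda>p. d *\<^sub>R (X p - (X 0 $ 3 / e 2 0 $ 3) *\<^sub>R e 2 p))"
        unfolding F fun_eq_iff using left_invariant_field_3[OF that] by metis
      then show ?thesis
        by (simp only: left_invariant_field_scale left_invariant_field_diff that e_left_invariant)
    qed
    have lin: "F (\<lambda>p. a *\<^sub>R X p + b *\<^sub>R Y p) = (\<lambda>p. a *\<^sub>R F X p + b *\<^sub>R F Y p)" for a b X Y
      by (simp add: F fun_eq_iff algebra_simps add_divide_distrib)
    \<comment> \<open>The image of \<open>F\<close> lies in the abelian ideal of translations, so
      one term drops out of each bracket formula on the right of the Leibniz rule.\<close>
    have F3: "F X p $ 3 = 0" for X p
      using e2_3[of p] e2_3_nz by (simp add: F)
    have "F (lie_bracket X Y) p = lie_bracket (F X) Y p + lie_bracket X (F Y) p"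
      if X: "left_invariant_field X" and Y: "left_invariant_field Y" for X Y p
      unfolding lie_bracket_left_invariant[OF inv[OF X] Y] lie_bracket_left_invariant[OF X inv[OF Y]] F3
      by (simp add: F lie_bracket_left_invariant[OF X Y] swap12_linear algebra_simps)
    then show ?thesis
      unfolding derivation_E11_def lie_algebra_E11_def using inv lin by (auto simp: fun_eq_iff)
  qed
  ultimately show ?thesis unfolding iff by blast
qed

text \<open>
  \<open>drift p\<close> is the point with the same third coordinate as \<open>p\<close> on the one-parameter subgroup generated by
  \<open>e 2\<close>; \<open>dilation k\<close> fixes this subgroup and stretches the normal subgroup of translations by \<open>k\<close>.
\<close>

definition drift :: "real^3 \<Rightarrow> real^3" where
  "drift p = (1 / e 2 0 $ 3) *\<^sub>R (swap12 (e 2 p) - swap12 (e 2 0)) + p $ 3 *\<^sub>R axis 3 1"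

definition dilation :: "real \<Rightarrow> real^3 \<Rightarrow> real^3" where
  "dilation k p = k *\<^sub>R p + (1 - k) *\<^sub>R drift p"

section \<open>Dilations and the metrics they pull back\<close>

lemma e_cong: "p $ 3 = q $ 3 \<Longrightarrow> e a p = e a q"
  using e_boost[of a p] e_boost[of a q] by simp

lemma dilation_3 [simp]: "dilation k p $ 3 = p $ 3"
  by (simp add: dilation_def drift_def algebra_simps)

lemma drift_cong: "p $ 3 = q $ 3 \<Longrightarrow> drift p = drift q"
  using e_cong[of p q 2] by (simp add: drift_def)

text \<open>\<open>drift\<close> sees only the third coordinate, which dilations keep, so the
  factors multiply. The inverse is then the dilation by 1/k.\<close>

lemma dilation_dilation: "dilation k (dilation l p) = dilation (k * l) p"
proof -
  have "drift (dilation l p) = drift p" by (rule drift_cong) simp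
  then show ?thesis by (simp add: dilation_def[of k] dilation_def[of "k * l"]) (simp add: dilation_def algebra_simps)
qed

lemma dilation_1 [simp]: "dilation 1 p = p"
  by (simp add: dilation_def)

text \<open>The derivative is the projection onto \<open>e 2\<close> along \<open>e 1\<close> and
  \<open>e 3\<close>: in the translation directions the two swaps cancel, and the axis term restores
  the third coordinate.\<close>

lemma drift_derivative: "(drift has_derivative (\<lambda>v. \<omega> 2 p v *\<^sub>R e 2 p)) (at p)"
proof -
  have sw: "((\<lambda>p. swap12 (e 2 p)) has_derivative (\<lambda>v. swap12 (v $ 3 *\<^sub>R swap12 (e 2 p)))) (at p)"
    by (rule bounded_linear.has_derivative[OF linear_conv_bounded_linear[THEN iffD1, OF linear_swap12]
          left_invariant_field_has_derivative[OF e_left_invariant]])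
  have "(drift has_derivative (\<lambda>v. (1 / e 2 0 $ 3) *\<^sub>R (swap12 (v $ 3 *\<^sub>R swap12 (e 2 p)) - 0) + v $ 3 *\<^sub>R axis 3 1)) (at p)"
    unfolding drift_def[abs_def]
    by (intro has_derivative_add has_derivative_scaleR_right has_derivative_diff has_derivative_const sw
        has_derivative_scaleR_left bounded_linear_imp_has_derivative[OF bounded_linear_vec_nth])
  moreover have "(1 / e 2 0 $ 3) *\<^sub>R (swap12 (v $ 3 *\<^sub>R swap12 (e 2 p)) - 0) + v $ 3 *\<^sub>R axis 3 1 = \<omega> 2 p v *\<^sub>R e 2 p" for v
    using e2_3_nz e2_3[of p] by (simp add: vec_eq_iff forall_3 \<omega>2 axis_def)
  ultimately show ?thesis by simp
qed

lemma frechet_derivative_dilation: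
  "frechet_derivative (dilation k) (at p) = (\<lambda>v. k *\<^sub>R v + (1 - k) *\<^sub>R \<omega> 2 p v *\<^sub>R e 2 p)"
  unfolding dilation_def[abs_def]
  by (rule frechet_derivative_at[symmetric])
     (intro has_derivative_add has_derivative_scaleR_right has_derivative_ident drift_derivative)

text \<open>The derivative of the dilation multiplies \<open>e 1\<close> and \<open>e 3\<close> by k
  and keeps \<open>e 2\<close>, as k + (1 - k) = 1. The metric is quadratic, whence the factor
  k^2.\<close>

lemma pullback_dilation:
  "pullback (dilation k) (diag_metric D) = diag_metric (\<lambda>a. if a = 2 then D a else k\<^sup>2 * D a)"
proof (intro ext)
  fix p v w
  have 1: "\<omega> a (dilation k p) v = \<omega> a p v" for a v
    by (rule \<omega>_cong) simp
  have "\<omega> a p (k *\<^sub>R v + (1 - k) *\<^sub>R \<omega> 2 p v *\<^sub>R e 2 p) = (if a = 2 then \<omega> a p v else k * \<omega> a p v)" for a v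
    unfolding linear_add[OF linear_\<omega>] linear_scale[OF linear_\<omega>] by (simp add: algebra_simps)
  then show "pullback (dilation k) (diag_metric D) p v w = diag_metric (\<lambda>a. if a = 2 then D a else k\<^sup>2 * D a) p v w"
    unfolding pullback_def frechet_derivative_dilation diag_metric_def 1 sum_3 by (simp add: power2_eq_square)
qed

text \<open>The linear map f allows two uses: the identity for smoothness of a single dilation, and
  \<open>snd\<close> for joint smoothness in time and space.\<close>

lemma smooth_on_drift:
  fixes f :: "'a::real_normed_vector \<Rightarrow> real^3"
  assumes "bounded_linear f"
  shows "smooth_on S (\<lambda>x. drift (f x))"
proof -
  have f3: "smooth_on S (\<lambda>x. f x $ 3)"
    by (rule smooth_on_bounded_linear[OF bounded_linear_compose[OF bounded_linear_vec_nth assms]])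
  show ?thesis
    unfolding drift_def e_boost[of 2 "f _"]
    by (intro smooth_on_add smooth_on_scaleR smooth_on_diff smooth_on_const f3 smooth_on_boost
        smooth_on_linear_comp[OF linear_conv_bounded_linear[THEN iffD1, OF linear_swap12]])
qed

lemma diffeomorphism_dilation:
  assumes "k \<noteq> 0"
  shows "diffeomorphism (dilation k)"
proof -
  have inv: "dilation k (dilation (1/k) p) = p" "dilation (1/k) (dilation k p) = p" for p
    using assms by (simp_all add: dilation_dilation)
  have smooth: "smooth_on UNIV (dilation l)" for l
    unfolding dilation_def[abs_def]
    by (intro smooth_on_add smooth_on_scaleR smooth_on_const smooth_on_drift smooth_on_bounded_linear bounded_linear_ident)
  have "bij (dilation k)"
    by (rule bij_betw_byWitness[where f' = "dilation (1/k)"]) (use inv in auto)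
  moreover have "inv (dilation k) = dilation (1/k)"
    using inv by (intro inv_equality)
  ultimately show ?thesis
    using smooth by (simp add: diffeomorphism_def)
qed

lemma diag_metric_gives_self_similar:
  assumes pos: "\<And>a. D a > 0" and \<rho>: "e11_rho \<alpha> D 2 = 0" "e11_rho \<alpha> D 1 = e11_rho \<alpha> D 3"
  shows "gives_self_similar_solution \<alpha> (diag_metric D)"
proof -
  define d where "d = e11_rho \<alpha> D 3"
  \<comment> \<open>With constant eigenvalues 0 on \<open>e 2\<close> and d on \<open>e 1\<close>
    and \<open>e 3\<close>, the flow equation is linear and these exponentials solve it.\<close>
  define Dt where "Dt t a = (if a = 2 then D a else exp (d * t) * D a)" for t a
  \<comment> \<open>The exponent is halved because the pullback squares the dilation factor.\<close>
  define \<phi> where "\<phi> t = dilation (exp (d * t / 2))" for t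
  have Dt_pos: "Dt t a > 0" for t a using pos[of a] by (auto simp: Dt_def)
  have rho: "e11_rho \<alpha> (Dt t) a = (if a = 2 then 0 else d)" for t a
  proof -
    have "e11_rho \<alpha> (Dt t) a = e11_rho \<alpha> D a"
      unfolding e11_rho_def using e11_sec_scale[of "exp (d * t)" "Dt t" D] by (simp add: Dt_def)
    then show ?thesis using \<rho> exhaust_3[of a] by (auto simp: d_def)
  qed
  have flow: "RG2_flow_on \<alpha> 1 (\<lambda>t. diag_metric (Dt t))"
    unfolding RG2_flow_on_def
  proof (intro ballI conjI allI)
    fix t p v w
    show "riemannian_metric (diag_metric (Dt t))" by (rule riemannian_diag_metric[of "Dt t", OF Dt_pos])
    have "((\<lambda>s. Dt s a) has_real_derivative e11_rho \<alpha> (Dt t) a * Dt t a) (at t within {0..<1})" for a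
      unfolding rho Dt_def by (cases "a = 2") (auto intro!: derivative_eq_intros)
    then have "((\<lambda>s. Dt s a * \<omega> a p v * \<omega> a p w) has_real_derivative
        e11_rho \<alpha> (Dt t) a * Dt t a * \<omega> a p v * \<omega> a p w) (at t within {0..<1})" for a
      by (intro DERIV_cmult_right)
    then show "((\<lambda>s. diag_metric (Dt s) p v w) has_real_derivative RG \<alpha> (diag_metric (Dt t)) p v w) (at t within {0..<1})"
      unfolding diag_metric_def RG_diag_metric[of "Dt t", OF Dt_pos] by (intro DERIV_sum)
  qed
  have 0: "diag_metric (Dt 0) = diag_metric D" "\<phi> 0 = id"
  proof -
    have "Dt 0 = D" by (simp add: Dt_def fun_eq_iff)
    then show "diag_metric (Dt 0) = diag_metric D" by simp
    show "\<phi> 0 = id" by (simp add: \<phi>_def fun_eq_iff)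
  qed
  have pb: "diag_metric (Dt t) = (\<lambda>p v w. 1 * pullback (\<phi> t) (diag_metric D) p v w)" for t
  proof -
    have "(exp (d * t / 2))\<^sup>2 = exp (d * t)" by (simp flip: exp_double)
    then show ?thesis by (simp only: \<phi>_def pullback_dilation Dt_def[abs_def] mult_1_left)
  qed
  have "smooth_on ({0..<1} \<times> UNIV) (\<lambda>z. dilation (exp (d * fst z / 2)) (snd z))"
  proof -
    have "bounded_linear (\<lambda>z::real \<times> (real^3). d * fst z / 2)"
      by (intro bounded_linear_divide[THEN bounded_linear_compose] bounded_linear_const_mult bounded_linear_fst)
    then show ?thesis
      unfolding dilation_def
      by (intro smooth_on_add smooth_on_scaleR smooth_on_diff smooth_on_const smooth_on_exp smooth_on_drift
          smooth_on_bounded_linear bounded_linear_snd)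
  qed
  then have sm: "smooth_on ({0..<1} \<times> UNIV) (\<lambda>(t, p). \<phi> t p)"
    by (simp add: case_prod_beta' \<phi>_def)
  have diff: "diffeomorphism (\<phi> t)" for t
    unfolding \<phi>_def by (rule diffeomorphism_dilation) simp
  have li: "left_invariant_metric (diag_metric (Dt t))" for t
    by (rule left_invariant_diag_metric[of "Dt t", OF Dt_pos])
  show ?thesis
    unfolding gives_self_similar_solution_def
    \<comment> \<open>The dilations account for the whole evolution, so c is constantly 1. The final
      time 1 is arbitrary, as the exponentials exist for all times.\<close>
    by (rule exI[of _ 1], rule conjI[OF zero_less_one], rule exI[of _ "\<lambda>t. diag_metric (Dt t)"],
        rule exI[of _ "\<lambda>t. 1"], rule exI[of _ \<phi>], intro conjI ballI flow 0 sm diff li pb refl)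
qed

end

theorem theorem3p9:
  fixes \<alpha> A B :: real
    and e :: "3 \<Rightarrow> 3 vfield"
    and \<omega> :: "3 \<Rightarrow> 3 oneform"
    and g :: "3 tensor2"
  assumes "\<alpha> > 0" and "A > 0" and "B > 0"
    and "left_invariant_frame e"
    and "lie_bracket (e 2) (e 3) = e 1"
    and "lie_bracket (e 1) (e 2) = (\<lambda>p. - e 3 p)"
    and "lie_bracket (e 3) (e 1) = (\<lambda>p. 0)"
    and "dual_coframe e \<omega>"
    and "g = (\<lambda>p v w. A * tensor_prod (\<omega> 1) (\<omega> 1) p v w
                     + B * tensor_prod (\<omega> 2) (\<omega> 2) p v w
                     + tensor_prod (\<omega> 3) (\<omega> 3) p v w)"
  shows "(steady_algebraic_soliton \<alpha> g \<and> gives_self_similar_solution \<alpha> g) \<longleftrightarrow>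
         (A = 1 \<and> \<alpha> = 2 * B) \<or> (A \<in> {1/3, 3} \<and> \<alpha> = 3/4 * B)"
proof -
  interpret e11_frame e \<omega>
    using assms(4-8) by unfold_locales
  define D :: "3 \<Rightarrow> real" where "D a = (if a = 1 then A else if a = 2 then B else 1)" for a
  have pos: "D a > 0" for a using assms(2,3) by (simp add: D_def)
  have g: "g = diag_metric D"
    by (simp add: assms(9) fun_eq_iff diag_metric_def tensor_prod_def sum_3 D_def)
  \<comment> \<open>The soliton equations already imply self-similarity, so the conjunction is
    equivalent to these equations alone.\<close>
  have "steady_algebraic_soliton \<alpha> g \<and> gives_self_similar_solution \<alpha> g
      \<longleftrightarrow> e11_rho \<alpha> D 2 = 0 \<and> e11_rho \<alpha> D 1 = e11_rho \<alpha> D 3"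
    unfolding g steady_diag_metric_iff[of D, OF pos]
    using diag_metric_gives_self_similar[of D, OF pos] by blast
  also have "\<dots> \<longleftrightarrow> (A = 1 \<and> \<alpha> = 2 * B) \<or> (A \<in> {1/3, 3} \<and> \<alpha> = 3/4 * B)"
    by (rule e11_soliton_equations) (use assms(2,3) in \<open>simp_all add: D_def\<close>)
  finally show ?thesis .
qed

end
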